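(* Let $(G,H)$ be a rooted graph, and write $\mu=\mu_{G,H}$, $\Phi=\Phi_{G,H}$, $X_{\mathbf{x}}=X_{G,H}(\mathbf{x})$. For all $p=p(n)\in[0,1]$: (i) If $\Phi=\Omega(1)$ and $t=t(n)>0$ satisfies $(t/\mu)^2\Phi\ge n^{\Omega(1)}$, then $\lim_{n\to\infty}\Pr\big(\max_{\mathbf{x}\in[n]_{v_G}}|X_{\mathbf{x}}-\mu|<t\big)=1$. (ii) If $\varepsilon=\varepsilon(n)\in(0,1]$ and either (a) $\Phi(1-p)\to\infty$ and $\varepsilon^2\Phi/(1-p)\to0$, or (b) $\Phi\to0$, then $\lim_{n\to\infty}\Pr\big(\max_{\mathbf{x}\in[n]_{v_G}}|X_{\mathbf{x}}-\mu|\ge\varepsilon\mu\big)=1$.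
   Context: $\mathbb{G}_{n,p}$ is the binomial random graph on $[n]=\{1,\dots,n\}$. For a graph $F$, $v_F,e_F$ are its numbers of vertices and edges. A rooted graph $(G,H)$ consists of a graph $H$ and an induced subgraph $G\subseteq H$ with labeled root vertices $V(G)=\{1,\dots,v_G\}$, with $e_H>e_G$. $[n]_{v_G}$ is the set of tuples $\mathbf{x}=(x_1,\dots,x_{v_G})$ of distinct vertices of $[n]$. A $(G,H)$-extension of $\mathbf{x}$ is a copy of $(V(H),E(H)\setminus E(G))$ in which each $j\in V(G)$ is mapped onto $x_j$ (counted as subgraphs). $X_{G,H}(\mathbf{x})$ is the number of $(G,H)$-extensions of $\mathbf{x}$ in $\mathbb{G}_{n,p}$ and $\mu_{G,H}=\mathbb{E}X_{G,H}(\mathbf{x})$. $\Phi_{G,H}=\min\{\mu_{G,J}: G\subseteq J\subseteq H,\ e_J>e_G\}$. $\Phi=\Omega(1)$ means $\Phi$ is bounded below by a positive constant; $a\ge n^{\Omega(1)}$ means $a\ge n^{c}$ for some constant $c>0$ and all large $n$. *)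

theory Defs
  imports "HOL-Probability.Probability"
begin

definition Kn_edges :: "nat \<Rightarrow> nat set set" where
  "Kn_edges n = {e. e \<subseteq> {1..n} \<and> card e = 2}"

definition Gnp :: "nat \<Rightarrow> real \<Rightarrow> nat set set pmf" where
  "Gnp n p = map_pmf (\<lambda>f. {e \<in> Kn_edges n. f e})
                     (Pi_pmf (Kn_edges n) False (\<lambda>_. bernoulli_pmf p))"

text \<open>A rooted graph (G,H): H has finite vertex set VH and edge set EH; the roots are
  V(G) = {1..vG} and G is the subgraph of H induced on them.\<close>
definition root_edges :: "nat \<Rightarrow> nat set set \<Rightarrow> nat set set" where
  "root_edges vG EH = {e \<in> EH. e \<subseteq> {1..vG}}"

definition rooted_graph :: "nat \<Rightarrow> nat set \<Rightarrow> nat set set \<Rightarrow> bool" where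
  "rooted_graph vG VH EH \<longleftrightarrow> finite VH \<and> {1..vG} \<subseteq> VH \<and>
     (\<forall>e\<in>EH. e \<subseteq> VH \<and> card e = 2) \<and> card (root_edges vG EH) < card EH"

text \<open>[n]_{vG}: tuples of vG distinct vertices of [n]; root j is mapped to xs ! (j-1).\<close>
definition tuples :: "nat \<Rightarrow> nat \<Rightarrow> nat list set" where
  "tuples n k = {xs. length xs = k \<and> distinct xs \<and> set xs \<subseteq> {1..n}}"

text \<open>Number of (G,H)-extensions of xs in the graph with edge set E (counted as subgraphs
  of K_n, i.e. as distinct pairs (vertex set, edge set) of the copies).\<close>
definition ext_count :: "nat \<Rightarrow> nat \<Rightarrow> nat set \<Rightarrow> nat set set \<Rightarrow> nat list \<Rightarrow> nat set set \<Rightarrow> nat" where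
  "ext_count n vG VH EH xs E = card
     {(\<phi> ` VH, (\<lambda>e. \<phi> ` e) ` (EH - root_edges vG EH)) | \<phi>.
        inj_on \<phi> VH \<and> \<phi> ` VH \<subseteq> {1..n} \<and> (\<forall>j\<in>{1..vG}. \<phi> j = xs ! (j - 1)) \<and>
        (\<forall>e \<in> EH - root_edges vG EH. \<phi> ` e \<in> E)}"

definition X_ext :: "nat \<Rightarrow> nat \<Rightarrow> nat set \<Rightarrow> nat set set \<Rightarrow> nat list \<Rightarrow> nat set set \<Rightarrow> real" where
  "X_ext n vG VH EH xs E = real (ext_count n vG VH EH xs E)"

text \<open>mu_{G,H} = E X_{G,H}(x); it does not depend on x, we use x = (1,...,vG).\<close>
definition mu_ext :: "nat \<Rightarrow> real \<Rightarrow> nat \<Rightarrow> nat set \<Rightarrow> nat set set \<Rightarrow> real" where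
  "mu_ext n p vG VH EH =
     measure_pmf.expectation (Gnp n p) (X_ext n vG VH EH [1..<vG+1])"

definition Phi_ext :: "nat \<Rightarrow> real \<Rightarrow> nat \<Rightarrow> nat set \<Rightarrow> nat set set \<Rightarrow> real" where
  "Phi_ext n p vG VH EH = Min {mu_ext n p vG VJ EJ | VJ EJ.
      {1..vG} \<subseteq> VJ \<and> VJ \<subseteq> VH \<and> root_edges vG EH \<subseteq> EJ \<and> EJ \<subseteq> EH \<and>
      (\<forall>e\<in>EJ. e \<subseteq> VJ) \<and> card (root_edges vG EH) < card EJ}"

end

theory Submission
  imports Defs
begin

text \<open>
  Write \<open>W = X - \<mu>\<close> as a sum of centred indicators \<open>Y i\<close> over the copies \<open>i\<close>; those of edge-disjoint
  copies are independent. Everything rests on one estimate: for an edge set \<open>F\<close> of bounded size,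
  the copies \<open>i\<close> meeting \<open>F\<close> satisfy \<open>\<Sum> p ^ card (S i - F) \<le> D\<close> with \<open>D = O(\<mu> / \<Phi>)\<close>, because fixing
  the intersection pattern with \<open>F\<close> fixes a subgraph \<open>J\<close> whose expected count is at least \<open>\<Phi>\<close>.

  (i) Expand \<open>E (W ^ (2 * k))\<close> over \<open>2 * k\<close>-tuples of copies. A tuple contributes only if each of its
  copies shares an edge with another one; then at most \<open>k\<close> of them dominate the others, so the
  estimate gives \<open>E (W ^ (2 * k)) = O((\<mu>\<^sup>2 / \<Phi>) ^ k)\<close>. Markov's inequality with \<open>k\<close> large
  beats the union bound over the at most \<open>n ^ vG\<close> root tuples.

  (ii) If \<open>\<Phi> \<rightarrow> 0\<close>, a single root tuple has no extension with high probability. In case (a) it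
  suffices that, for a single root tuple, \<open>W\<close> puts mass \<open>O(\<delta>) + o(1)\<close> on the interval of radius
  \<open>\<delta> \<sigma>\<close>, where \<open>\<sigma>\<^sup>2 = E (W\<^sup>2) \<ge> (1 - p) \<mu>\<^sup>2 / \<Phi>\<close>. This follows from Stein's method, whose third-order
  error terms are bounded by \<open>O((1 - p) \<mu> D\<^sup>2)\<close>, so that no central limit theorem is needed.
\<close>

subsection \<open>Expectation over random subsets\<close>

text \<open>The expectation when every element of \<open>K\<close> is kept independently with
  probability \<open>p\<close>, written as a finite sum so that integrability never has to be
  discussed.\<close>

definition bexp :: "'e set \<Rightarrow> real \<Rightarrow> ('e set \<Rightarrow> real) \<Rightarrow> real" where
  "bexp K p g = (\<Sum>E\<in>Pow K. p ^ card E * (1 - p) ^ card (K - E) * g E)"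

text \<open>\<open>E\<close> corresponds to the pair \<open>(E \<inter> A, E - A)\<close>, and the
  Bernoulli weight of \<open>E\<close> is the product of the weights of the two parts.\<close>

lemma bexp_split:
  assumes "finite K" "A \<subseteq> K"
  shows "bexp K p g = (\<Sum>E1\<in>Pow A. \<Sum>E2\<in>Pow (K - A).
    (p ^ card E1 * (1 - p) ^ card (A - E1)) * (p ^ card E2 * (1 - p) ^ card (K - A - E2)) * g (E1 \<union> E2))"
proof -
  have "bexp K p g = (\<Sum>(E1, E2)\<in>Pow A \<times> Pow (K - A).
    (p ^ card E1 * (1 - p) ^ card (A - E1)) * (p ^ card E2 * (1 - p) ^ card (K - A - E2)) * g (E1 \<union> E2))"
    unfolding bexp_def
  proof (rule sum.reindex_bij_witness[where j = "\<lambda>E. (E \<inter> A, E - A)" and i = "\<lambda>(E1, E2). E1 \<union> E2"])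
    fix E assume E: "E \<in> Pow K"
    have fin: "finite E" "finite A" "finite (K - A)" "finite (K - E)"
      using E assms by (auto intro: finite_subset)
    have "card ((E \<inter> A) \<union> (E - A)) = card (E \<inter> A) + card (E - A)"
      using fin by (intro card_Un_disjoint) auto
    moreover have "(E \<inter> A) \<union> (E - A) = E" by auto
    ultimately have 1: "card E = card (E \<inter> A) + card (E - A)" by simp
    have "card ((A - E \<inter> A) \<union> (K - A - (E - A))) = card (A - E \<inter> A) + card (K - A - (E - A))"
      using fin by (intro card_Un_disjoint) auto
    moreover have "(A - E \<inter> A) \<union> (K - A - (E - A)) = K - E" using E assms(2) by auto
    ultimately have 2: "card (K - E) = card (A - E \<inter> A) + card (K - A - (E - A))" by simp
    have 3: "E \<inter> A \<union> (E - A) = E" by auto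
    show "(case (E \<inter> A, E - A) of (E1, E2) \<Rightarrow>
        (p ^ card E1 * (1 - p) ^ card (A - E1)) * (p ^ card E2 * (1 - p) ^ card (K - A - E2)) * g (E1 \<union> E2)) =
        p ^ card E * (1 - p) ^ card (K - E) * g E"
      unfolding prod.case 3 unfolding 1 2 by (simp add: power_add mult_ac)
  qed (use assms in auto)
  then show ?thesis by (simp add: sum.cartesian_product)
qed

text \<open>Expand the product over \<open>K\<close> of the factors
  \<open>p + (1 - p)\<close>.\<close>

lemma bexp_one: "finite K \<Longrightarrow> bexp K p (\<lambda>_. 1) = 1"
  using prod_add[of K "\<lambda>_. p" "\<lambda>_. 1 - p"] by (simp add: bexp_def)

text \<open>Independence of functions of disjoint edge sets. That \<open>g\<close> sees only the
  edges in \<open>A\<close> and \<open>h\<close> only those outside is expressed by invariance under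
  deleting the other edges; after \<open>bexp_split\<close> the double sum factors.\<close>

lemma bexp_indep:
  assumes "finite K" "A \<subseteq> K"
    and g: "\<And>E. E \<subseteq> K \<Longrightarrow> g (E \<inter> A) = g E" and h: "\<And>E. E \<subseteq> K \<Longrightarrow> h (E - A) = h E"
  shows "bexp K p (\<lambda>E. g E * h E) = bexp K p g * bexp K p h"
proof -
  have gU: "g (E1 \<union> E2) = g E1" if "E1 \<subseteq> A" "E2 \<subseteq> K - A" for E1 E2
  proof -
    have "(E1 \<union> E2) \<inter> A = E1" "E1 \<union> E2 \<subseteq> K" using that assms(2) by auto
    then show ?thesis using g[of "E1 \<union> E2"] by simp
  qed
  have hU: "h (E1 \<union> E2) = h E2" if "E1 \<subseteq> A" "E2 \<subseteq> K - A" for E1 E2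
  proof -
    have "(E1 \<union> E2) - A = E2" "E1 \<union> E2 \<subseteq> K" using that assms(2) by auto
    then show ?thesis using h[of "E1 \<union> E2"] by simp
  qed
  have fA: "finite A" using assms(1,2) finite_subset by blast
  have "bexp K p (\<lambda>E. g E * h E) = (\<Sum>E1\<in>Pow A. \<Sum>E2\<in>Pow (K - A).
    (p ^ card E1 * (1 - p) ^ card (A - E1) * g E1) * (p ^ card E2 * (1 - p) ^ card (K - A - E2) * h E2))"
    unfolding bexp_split[OF assms(1,2)] by (intro sum.cong refl) (simp add: gU hU)
  also have "\<dots> = bexp A p g * bexp (K - A) p h"
    by (simp add: bexp_def sum_product)
  finally have 1: "bexp K p (\<lambda>E. g E * h E) = bexp A p g * bexp (K - A) p h" .
  have "bexp K p g = (\<Sum>E1\<in>Pow A. \<Sum>E2\<in>Pow (K - A).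
    (p ^ card E1 * (1 - p) ^ card (A - E1) * g E1) * (p ^ card E2 * (1 - p) ^ card (K - A - E2) * 1))"
    unfolding bexp_split[OF assms(1,2)] by (intro sum.cong refl) (simp add: gU)
  also have "\<dots> = bexp A p g * bexp (K - A) p (\<lambda>_. 1)"
    by (simp only: bexp_def sum_product)
  finally have 2: "bexp K p g = bexp A p g" using assms(1) by (simp add: bexp_one)
  have "bexp K p h = (\<Sum>E1\<in>Pow A. \<Sum>E2\<in>Pow (K - A).
    (p ^ card E1 * (1 - p) ^ card (A - E1) * 1) * (p ^ card E2 * (1 - p) ^ card (K - A - E2) * h E2))"
    unfolding bexp_split[OF assms(1,2)] by (intro sum.cong refl) (simp add: hU)
  also have "\<dots> = bexp A p (\<lambda>_. 1) * bexp (K - A) p h"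
    by (simp only: bexp_def sum_product)
  finally have 3: "bexp K p h = bexp (K - A) p h" using fA by (simp add: bexp_one)
  show ?thesis using 1 2 3 by simp
qed

lemma bexp_subset:
  assumes "finite K" "F \<subseteq> K"
  shows "bexp K p (\<lambda>E. of_bool (F \<subseteq> E)) = p ^ card F"
proof -
  have fF: "finite F" using assms finite_subset by auto
  have "bexp K p (\<lambda>E. of_bool (F \<subseteq> E)) = (\<Sum>E1\<in>Pow F. \<Sum>E2\<in>Pow (K - F).
    (p ^ card E1 * (1 - p) ^ card (F - E1) * of_bool (F \<subseteq> E1)) * (p ^ card E2 * (1 - p) ^ card (K - F - E2) * 1))"
    unfolding bexp_split[OF assms] by (intro sum.cong refl) (auto simp: of_bool_def)
  also have "\<dots> = (\<Sum>E1\<in>Pow F. p ^ card E1 * (1 - p) ^ card (F - E1) * of_bool (F \<subseteq> E1)) * bexp (K - F) p (\<lambda>_. 1)"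
    by (simp only: bexp_def sum_product)
  also have "\<dots> = (\<Sum>E1\<in>Pow F. if E1 = F then p ^ card F else 0)"
    using assms(1) by (simp only: bexp_one finite_Diff mult_1_right) (intro sum.cong refl, auto)
  also have "\<dots> = p ^ card F" using fF by simp
  finally show ?thesis .
qed

locale random_subset =
  fixes K :: "'e set" and p :: real
  assumes finite_K: "finite K" and p0: "0 \<le> p" and p1: "p \<le> 1"
begin

abbreviation ex where "ex \<equiv> bexp K p"

lemma ex_mono: "(\<And>E. E \<subseteq> K \<Longrightarrow> g E \<le> h E) \<Longrightarrow> ex g \<le> ex h"
  unfolding bexp_def using p0 p1 by (intro sum_mono mult_left_mono) auto

lemma ex_cong: "(\<And>E. E \<subseteq> K \<Longrightarrow> g E = h E) \<Longrightarrow> ex g = ex h"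
  unfolding bexp_def by (intro sum.cong) auto

lemma ex_add: "ex (\<lambda>E. g E + h E) = ex g + ex h"
  by (simp add: bexp_def sum.distrib algebra_simps)

lemma ex_diff: "ex (\<lambda>E. g E - h E) = ex g - ex h"
  by (simp add: bexp_def sum_subtractf algebra_simps)

lemma ex_cmult: "ex (\<lambda>E. c * g E) = c * ex g"
  by (simp add: bexp_def sum_distrib_left mult_ac)

lemma ex_cdiv: "ex (\<lambda>E. g E / c) = ex g / c"
  using ex_cmult[of "1/c" g] by simp

lemma ex_sum: "ex (\<lambda>E. \<Sum>i\<in>A. g i E) = (\<Sum>i\<in>A. ex (g i))"
  unfolding bexp_def sum_distrib_left by (rule sum.swap)

lemma ex_const: "ex (\<lambda>_. c) = c"
  using ex_cmult[of c "\<lambda>_. 1"] bexp_one[OF finite_K, of p] by simp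

lemma ex_nonneg: "(\<And>E. E \<subseteq> K \<Longrightarrow> 0 \<le> g E) \<Longrightarrow> 0 \<le> ex g"
  using ex_mono[of "\<lambda>_. 0" g] by (simp add: ex_const)

lemma ex_abs: "\<bar>ex g\<bar> \<le> ex (\<lambda>E. \<bar>g E\<bar>)"
  unfolding abs_le_iff using ex_mono[of g "\<lambda>E. \<bar>g E\<bar>"] ex_mono[of "\<lambda>E. - \<bar>g E\<bar>" g]
    ex_cmult[of "-1" "\<lambda>E. \<bar>g E\<bar>"] by fastforce

text \<open>The variance of \<open>\<bar>g E\<bar>\<close> is nonnegative.\<close>

lemma ex_abs_sq: "(ex (\<lambda>E. \<bar>g E\<bar>))\<^sup>2 \<le> ex (\<lambda>E. (g E)\<^sup>2)"
proof -
  let ?m = "ex (\<lambda>E. \<bar>g E\<bar>)"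
  have "0 \<le> ex (\<lambda>E. (\<bar>g E\<bar> - ?m)\<^sup>2)" by (rule ex_nonneg) simp
  also have "ex (\<lambda>E. (\<bar>g E\<bar> - ?m)\<^sup>2) = ex (\<lambda>E. ((g E)\<^sup>2 - 2 * ?m * \<bar>g E\<bar>) + ?m\<^sup>2)"
    by (rule ex_cong) (simp add: power2_diff)
  also have "\<dots> = ex (\<lambda>E. (g E)\<^sup>2) - 2 * ?m * ?m + ?m\<^sup>2"
    by (simp only: ex_add ex_diff ex_cmult ex_const)
  finally show ?thesis by (simp add: power2_eq_square)
qed

lemma ex_markov:
  assumes "0 < c" "\<And>E. E \<subseteq> K \<Longrightarrow> 0 \<le> g E"
  shows "ex (\<lambda>E. of_bool (c \<le> g E)) \<le> ex g / c"
proof -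
  have "c * ex (\<lambda>E. of_bool (c \<le> g E)) \<le> ex g"
    unfolding ex_cmult[symmetric] using assms by (intro ex_mono) auto
  then show ?thesis using assms(1) by (simp add: field_simps)
qed

end

subsection \<open>Sums of centred indicators\<close>

text \<open>Indices are kept apart from edge sets because \<open>S\<close> need not be injective:
  copies that differ only in isolated vertices have the same edge set.\<close>

locale copies = random_subset K p for K :: "'e set" and p :: real +
  fixes I :: "'i set" and S :: "'i \<Rightarrow> 'e set" and l :: nat
  assumes finite_I: "finite I" and S_sub: "\<And>i. i \<in> I \<Longrightarrow> S i \<subseteq> K"
    and card_S: "\<And>i. i \<in> I \<Longrightarrow> card (S i) = l"
begin

definition Y :: "'i \<Rightarrow> 'e set \<Rightarrow> real" where "Y i E = of_bool (S i \<subseteq> E) - p ^ l"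

definition W :: "'e set \<Rightarrow> real" where "W E = (\<Sum>i\<in>I. Y i E)"

definition M :: real where "M = (\<Sum>i\<in>I. p ^ card (S i))"

text \<open>Given that all edges of \<open>F\<close> are present, \<open>p ^ card (S i - F)\<close>
  is the conditional probability of copy \<open>i\<close>. So \<open>D\<close> bounds the
  conditional expected number of copies meeting \<open>F\<close>, and \<open>m\<close> allows
  \<open>F\<close> to be the union of up to \<open>m\<close> copies.\<close>

definition overlap :: "nat \<Rightarrow> real \<Rightarrow> bool" where
  "overlap m D \<longleftrightarrow> (\<forall>F\<subseteq>K. card F \<le> m * l \<longrightarrow> (\<Sum>i\<in>{i\<in>I. S i \<inter> F \<noteq> {}}. p ^ card (S i - F)) \<le> D)"

lemma pl: "0 \<le> p ^ l" "p ^ l \<le> 1"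
  using p0 p1 by (auto simp: power_le_one)

lemma finite_S: "i \<in> I \<Longrightarrow> finite (S i)"
  using S_sub finite_K finite_subset by blast

lemma Y_abs: "\<bar>Y i E\<bar> \<le> 1" "\<bar>Y i E\<bar> \<le> of_bool (S i \<subseteq> E) + p ^ l"
  unfolding Y_def using pl by auto

lemma Y_depends: "i \<in> I \<Longrightarrow> S i \<subseteq> A \<Longrightarrow> Y i (E \<inter> A) = Y i E"
  unfolding Y_def by (auto simp: of_bool_def)

lemma Y_depends': "S i \<inter> A = {} \<Longrightarrow> Y i (E - A) = Y i E"
  unfolding Y_def by (auto simp: of_bool_def)

lemma ex_Y: "i \<in> I \<Longrightarrow> ex (Y i) = 0"
  unfolding Y_def[abs_def] ex_diff ex_const by (simp add: bexp_subset finite_K S_sub card_S)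

text \<open>The factor \<open>of_bool (S i \<subseteq> E) + p ^ l\<close> dominates
  \<open>\<bar>Y i E\<bar>\<close>. Its first term enlarges \<open>F\<close> by \<open>S i\<close>;
  its second equals \<open>p ^ card (S i)\<close>, which fits the same bound because the size of a
  union is at most the sum of the sizes. The two terms double the constant. The bound on
  \<open>g\<close> is required for every \<open>F\<close> so that the step can be iterated.\<close>

lemma ex_of_bool_prod_step:
  assumes "i \<in> I" "R \<subseteq> K"
    and g: "\<And>F. F \<subseteq> K \<Longrightarrow> ex (\<lambda>E. of_bool (F \<subseteq> E) * g E) \<le> c * p ^ card (F \<union> R)"
    and F: "F \<subseteq> K" and c: "0 \<le> c"
  shows "ex (\<lambda>E. of_bool (F \<subseteq> E) * ((of_bool (S i \<subseteq> E) + p ^ l) * g E)) \<le> (2 * c) * p ^ card (F \<union> (S i \<union> R))"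
proof -
  have "ex (\<lambda>E. of_bool (F \<subseteq> E) * ((of_bool (S i \<subseteq> E) + p ^ l) * g E))
    = ex (\<lambda>E. of_bool (F \<union> S i \<subseteq> E) * g E + p ^ l * (of_bool (F \<subseteq> E) * g E))"
    by (rule ex_cong) (auto simp: of_bool_def algebra_simps)
  also have "\<dots> \<le> c * p ^ card (F \<union> S i \<union> R) + p ^ l * (c * p ^ card (F \<union> R))"
    unfolding ex_add ex_cmult using F S_sub[OF assms(1)] pl by (intro add_mono g mult_left_mono) auto
  also have "p ^ l * (c * p ^ card (F \<union> R)) = c * p ^ (card (S i) + card (F \<union> R))"
    using card_S[OF assms(1)] by (simp add: power_add)
  also have "\<dots> \<le> c * p ^ card (F \<union> S i \<union> R)"
  proof -
    have "card (F \<union> S i \<union> R) = card (S i \<union> (F \<union> R))" by (simp add: Un_ac)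
    then have "card (F \<union> S i \<union> R) \<le> card (S i) + card (F \<union> R)" by (simp add: card_Un_le)
    then show ?thesis using p0 p1 c by (intro mult_left_mono power_decreasing) auto
  qed
  finally show ?thesis by (simp add: Un_assoc)
qed

lemma ex_prod_Y_bound:
  assumes "finite T" "\<And>j. j \<in> T \<Longrightarrow> a j \<in> I"
  shows "F \<subseteq> K \<Longrightarrow> ex (\<lambda>E. of_bool (F \<subseteq> E) * (\<Prod>j\<in>T. of_bool (S (a j) \<subseteq> E) + p ^ l))
    \<le> 2 ^ card T * p ^ card (F \<union> (\<Union>j\<in>T. S (a j)))"
  using assms
proof (induction T arbitrary: F rule: finite_induct)
  case empty
  then show ?case by (simp add: bexp_subset finite_K)
next
  case (insert j T)
  have "ex (\<lambda>E. of_bool (F \<subseteq> E) * ((of_bool (S (a j) \<subseteq> E) + p ^ l) * (\<Prod>j\<in>T. of_bool (S (a j) \<subseteq> E) + p ^ l)))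
    \<le> (2 * 2 ^ card T) * p ^ card (F \<union> (S (a j) \<union> (\<Union>j\<in>T. S (a j))))"
    using insert.prems S_sub by (intro ex_of_bool_prod_step insert.IH) auto
  then show ?case using insert.hyps by simp
qed

lemma ex_prod_Y:
  assumes "finite T" "\<And>j. j \<in> T \<Longrightarrow> a j \<in> I"
  shows "\<bar>ex (\<lambda>E. \<Prod>j\<in>T. Y (a j) E)\<bar> \<le> 2 ^ card T * p ^ card (\<Union>j\<in>T. S (a j))"
proof -
  have "\<bar>ex (\<lambda>E. \<Prod>j\<in>T. Y (a j) E)\<bar> \<le> ex (\<lambda>E. \<bar>\<Prod>j\<in>T. Y (a j) E\<bar>)" by (rule ex_abs)
  also have "\<dots> \<le> ex (\<lambda>E. of_bool ({} \<subseteq> E) * (\<Prod>j\<in>T. of_bool (S (a j) \<subseteq> E) + p ^ l))"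
    unfolding abs_prod using Y_abs(2) by (intro ex_mono) (auto intro!: prod_mono)
  also have "\<dots> \<le> 2 ^ card T * p ^ card ({} \<union> (\<Union>j\<in>T. S (a j)))"
    using ex_prod_Y_bound[where F = "{}", OF assms] by simp
  finally show ?thesis by simp
qed

text \<open>The factor of \<open>j0\<close> uses edges that no other factor uses, so it splits off
  by independence, and its mean is zero.\<close>

lemma ex_prod_Y_isolated:
  assumes "finite T" "\<And>j. j \<in> T \<Longrightarrow> a j \<in> I" "j0 \<in> T"
    and iso: "\<And>j. j \<in> T \<Longrightarrow> j \<noteq> j0 \<Longrightarrow> S (a j) \<inter> S (a j0) = {}"
  shows "ex (\<lambda>E. \<Prod>j\<in>T. Y (a j) E) = 0"
proof -
  have "ex (\<lambda>E. \<Prod>j\<in>T. Y (a j) E) = ex (\<lambda>E. Y (a j0) E * (\<Prod>j\<in>T - {j0}. Y (a j) E))"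
    using assms by (simp add: prod.remove)
  also have "\<dots> = ex (Y (a j0)) * ex (\<lambda>E. \<Prod>j\<in>T - {j0}. Y (a j) E)"
    using assms(2,3) S_sub iso
    by (intro bexp_indep[where A = "S (a j0)"] finite_K prod.cong Y_depends Y_depends') auto
  finally show ?thesis using assms ex_Y by simp
qed

end

subsection \<open>Moments\<close>

text \<open>A graph without isolated vertices is dominated by at most half of its vertices, because
  the complement of a dominating set of least size dominates as well.\<close>

lemma dominating_set:
  assumes "finite V" and sym: "\<And>x y. R x y \<Longrightarrow> R y x"
    and nb: "\<And>v. v \<in> V \<Longrightarrow> \<exists>u\<in>V. u \<noteq> v \<and> R v u"
  obtains D where "D \<subseteq> V" "2 * card D \<le> card V" "\<And>v. v \<in> V - D \<Longrightarrow> \<exists>u\<in>D. R v u"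
proof -
  define P where "P D \<longleftrightarrow> D \<subseteq> V \<and> (\<forall>v\<in>V - D. \<exists>u\<in>D. R v u)" for D
  have "P V" by (simp add: P_def)
  then obtain D where D: "P D" and min: "\<And>D'. P D' \<Longrightarrow> card D \<le> card D'"
    using ex_has_least_nat[of P V card] by blast
  have DV: "D \<subseteq> V" "finite D" using D assms(1) finite_subset by (auto simp: P_def)
  have "P (V - D)"
    unfolding P_def
  proof (intro conjI ballI)
    fix v assume "v \<in> V - (V - D)"
    then have v: "v \<in> D" "v \<in> V" by auto
    show "\<exists>u\<in>V - D. R v u"
    proof (rule ccontr)
      assume no: "\<not> (\<exists>u\<in>V - D. R v u)"
      have "P (D - {v})"
        unfolding P_def
      proof (intro conjI ballI)
        fix w assume w: "w \<in> V - (D - {v})"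
        show "\<exists>u\<in>D - {v}. R w u"
        proof (cases "w = v")
          case True
          obtain u where "u \<in> V" "u \<noteq> v" "R v u" using nb[OF v(2)] by blast
          then show ?thesis using no True by blast
        next
          case False
          then have w': "w \<in> V - D" using w by auto
          then obtain u where "u \<in> D" "R w u" using D by (auto simp: P_def)
          then show ?thesis using no sym w' by blast
        qed
      qed (use DV in auto)
      then have "card D \<le> card (D - {v})" by (rule min)
      then show False using card_Diff1_less[OF DV(2) v(1)] by linarith
    qed
  qed auto
  then have "card D \<le> card (V - D)" by (rule min)
  then have "2 * card D \<le> card V" using DV assms(1) by (simp add: card_Diff_subset)
  then show thesis using that D by (auto simp: P_def)
qed

lemma sum_UN_le:
  fixes f :: "'b \<Rightarrow> real"
  assumes "finite A" "\<And>x. x \<in> A \<Longrightarrow> finite (B x)" "\<And>y. 0 \<le> f y"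
  shows "sum f (\<Union>x\<in>A. B x) \<le> (\<Sum>x\<in>A. sum f (B x))"
  using assms(1,2)
proof (induction A rule: finite_induct)
  case (insert x A)
  have "sum f (B x \<union> (\<Union>x\<in>A. B x)) \<le> sum f (B x) + sum f (\<Union>x\<in>A. B x)"
    using insert assms(3) by (subst sum_Un) (auto simp: sum_nonneg)
  then show ?case using insert by auto
qed simp

context copies
begin

lemma card_UN_S_le: 
  assumes "finite T" "a \<in> T \<rightarrow>\<^sub>E I"
  shows "card (\<Union>j\<in>T. S (a j)) \<le> card T * l"
proof -
  have "card (\<Union>j\<in>T. S (a j)) \<le> (\<Sum>j\<in>T. card (S (a j)))" by (rule card_UN_le[OF assms(1)])
  also have "\<dots> = (\<Sum>j\<in>T. l)" using assms by (intro sum.cong) (auto simp: card_S dest: PiE_mem)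
  finally show ?thesis by simp
qed

lemma UN_S_sub: "a \<in> T \<rightarrow>\<^sub>E I \<Longrightarrow> (\<Union>j\<in>T. S (a j)) \<subseteq> K"
  using S_sub by (auto dest: PiE_mem)

text \<open>Adding a coordinate \<open>j\<close> with value \<open>i\<close> enlarges the union by
  the edges of \<open>S i\<close> that are new, so the power of \<open>p\<close> factors and the sum
  over \<open>i\<close> can be bounded first. The families \<open>A\<close> and \<open>B\<close> are
  left general to cover both all tuples and the dominated ones.\<close>

lemma tuple_step:
  assumes T: "finite T" "j \<notin> T" and A: "A \<subseteq> T \<rightarrow>\<^sub>E I" and B: "B \<subseteq> insert j T \<rightarrow>\<^sub>E I"
    and res: "\<And>b. b \<in> B \<Longrightarrow> restrict b T \<in> A"
    and bd: "\<And>a. a \<in> A \<Longrightarrow>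
      (\<Sum>i\<in>{i\<in>I. a(j := i) \<in> B}. p ^ card (S i - (\<Union>k\<in>T. S (a k)))) \<le> c"
  shows "(\<Sum>b\<in>B. p ^ card (\<Union>k\<in>insert j T. S (b k))) \<le> c * (\<Sum>a\<in>A. p ^ card (\<Union>k\<in>T. S (a k)))"
proof -
  have finA: "finite A" using finite_subset[OF A finite_PiE[OF T(1) finite_I]] .
  have "(\<Sum>b\<in>B. p ^ card (\<Union>k\<in>insert j T. S (b k))) =
    (\<Sum>(a, i)\<in>Sigma A (\<lambda>a. {i\<in>I. a(j := i) \<in> B}).
        p ^ card (\<Union>k\<in>T. S (a k)) * p ^ card (S i - (\<Union>k\<in>T. S (a k))))"
  proof (rule sum.reindex_bij_witness[where i = "\<lambda>(a, i). a(j := i)" and j = "\<lambda>b. (restrict b T, b j)"])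
    fix b assume b: "b \<in> B"
    have bP: "b \<in> insert j T \<rightarrow>\<^sub>E I" using b B by auto
    have upd: "(restrict b T)(j := b j) = b"
      using bP T by (auto simp: restrict_def fun_eq_iff PiE_def extensional_def)
    show "(case (restrict b T, b j) of (a, i) \<Rightarrow> a(j := i)) = b" using upd by simp
    show "(restrict b T, b j) \<in> Sigma A (\<lambda>a. {i\<in>I. a(j := i) \<in> B})"
      using b bP res upd by auto
    have "finite (\<Union>k\<in>T. S (b k))" using bP T finite_S by (auto dest: PiE_mem)
    moreover have "finite (S (b j))" using bP finite_S by auto
    moreover have "(\<Union>k\<in>insert j T. S (b k)) = (\<Union>k\<in>T. S (b k)) \<union> (S (b j) - (\<Union>k\<in>T. S (b k)))"
      by auto
    ultimately have "card (\<Union>k\<in>insert j T. S (b k)) =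
      card (\<Union>k\<in>T. S (b k)) + card (S (b j) - (\<Union>k\<in>T. S (b k)))"
      by (metis Diff_disjoint card_Un_disjoint finite_Diff)
    then show "(case (restrict b T, b j) of (a, i) \<Rightarrow>
       p ^ card (\<Union>k\<in>T. S (a k)) * p ^ card (S i - (\<Union>k\<in>T. S (a k)))) = p ^ card (\<Union>k\<in>insert j T. S (b k))"
      by (simp add: power_add)
  next
    fix ai assume "ai \<in> Sigma A (\<lambda>a. {i\<in>I. a(j := i) \<in> B})"
    then obtain a i where ai: "ai = (a, i)" "a \<in> A" "i \<in> I" "a(j := i) \<in> B" by auto
    have "a \<in> T \<rightarrow>\<^sub>E I" using ai A by auto
    then have "restrict (a(j := i)) T = a"
      using T by (auto simp: restrict_def fun_eq_iff PiE_def extensional_def)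
    then show "(restrict (case ai of (a, i) \<Rightarrow> a(j := i)) T, (case ai of (a, i) \<Rightarrow> a(j := i)) j) = ai"
      using ai by simp
    show "(case ai of (a, i) \<Rightarrow> a(j := i)) \<in> B" using ai by simp
  qed
  also have "\<dots> = (\<Sum>a\<in>A. p ^ card (\<Union>k\<in>T. S (a k)) *
      (\<Sum>i\<in>{i\<in>I. a(j := i) \<in> B}. p ^ card (S i - (\<Union>k\<in>T. S (a k)))))"
    using finA finite_I by (simp add: sum.Sigma sum_distrib_left)
  also have "\<dots> \<le> (\<Sum>a\<in>A. p ^ card (\<Union>k\<in>T. S (a k)) * c)"
    using p0 bd by (intro sum_mono mult_left_mono) auto
  finally show ?thesis by (simp add: sum_distrib_left mult.commute)
qed

lemma M_nonneg: "0 \<le> M"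
  unfolding M_def using p0 by (intro sum_nonneg) auto

lemma M_eq: "M = card I * p ^ l"
  unfolding M_def by (simp add: card_S)

lemma overlap_nonneg: "overlap m D \<Longrightarrow> 0 \<le> D"
  unfolding overlap_def by (drule spec[of _ "{}"]) simp

text \<open>Copies disjoint from \<open>F\<close> contribute at most \<open>M\<close>, the others at
  most \<open>D\<close>.\<close>

lemma overlap_all:
  assumes "overlap m D" "F \<subseteq> K" "card F \<le> m * l"
  shows "(\<Sum>i\<in>I. p ^ card (S i - F)) \<le> M + D"
proof -
  have "(\<Sum>i\<in>I. p ^ card (S i - F)) = (\<Sum>i\<in>{i\<in>I. S i \<inter> F = {}}. p ^ card (S i - F))
     + (\<Sum>i\<in>{i\<in>I. S i \<inter> F \<noteq> {}}. p ^ card (S i - F))"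
    using finite_I by (subst sum.union_disjoint[symmetric]) (auto intro: sum.cong)
  also have "(\<Sum>i\<in>{i\<in>I. S i \<inter> F = {}}. p ^ card (S i - F)) = (\<Sum>i\<in>{i\<in>I. S i \<inter> F = {}}. p ^ card (S i))"
    by (intro sum.cong) (auto simp: Diff_triv)
  also have "\<dots> \<le> M" unfolding M_def using finite_I p0 by (intro sum_mono2) auto
  also have "(\<Sum>i\<in>{i\<in>I. S i \<inter> F \<noteq> {}}. p ^ card (S i - F)) \<le> D"
    using assms by (simp add: overlap_def)
  finally show ?thesis by simp
qed

lemma sum_tuples_le:
  assumes ov: "overlap m D" and "finite T" "card T \<le> m"
  shows "(\<Sum>a\<in>T \<rightarrow>\<^sub>E I. p ^ card (\<Union>j\<in>T. S (a j))) \<le> (M + D) ^ card T"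
  using assms(2,3)
proof (induction T rule: finite_induct)
  case empty
  then show ?case by simp
next
  case (insert j T)
  have "(\<Sum>a\<in>insert j T \<rightarrow>\<^sub>E I. p ^ card (\<Union>j\<in>insert j T. S (a j)))
    \<le> (M + D) * (\<Sum>a\<in>T \<rightarrow>\<^sub>E I. p ^ card (\<Union>j\<in>T. S (a j)))"
  proof (rule tuple_step)
    fix a assume a: "a \<in> T \<rightarrow>\<^sub>E I"
    have "card (\<Union>k\<in>T. S (a k)) \<le> m * l"
      using card_UN_S_le[OF insert.hyps(1) a] insert.prems insert.hyps
      by (metis card_insert_disjoint Suc_leD mult_le_mono1 order_trans)
    moreover have "{i \<in> I. a(j := i) \<in> insert j T \<rightarrow>\<^sub>E I} = I"
      using PiE_fun_upd[of _ "\<lambda>_. I" j a T] a by auto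
    ultimately show "(\<Sum>i\<in>{i \<in> I. a(j := i) \<in> insert j T \<rightarrow>\<^sub>E I}. p ^ card (S i - (\<Union>k\<in>T. S (a k)))) \<le> M + D"
      using overlap_all[OF ov UN_S_sub[OF a]] by simp
  qed (use insert.hyps in auto)
  also have "\<dots> \<le> (M + D) * (M + D) ^ card T"
    using insert M_nonneg overlap_nonneg[OF ov] by (intro mult_left_mono) auto
  finally show ?case using insert.hyps by simp
qed

text \<open>\<open>D0\<close> will be a dominating set in the graph that joins two coordinates when
  their copies share an edge, and \<open>T\<close> its complement.\<close>

definition dominated :: "'k set \<Rightarrow> 'k set \<Rightarrow> ('k \<Rightarrow> 'i) set" where
  "dominated D0 T = {a \<in> D0 \<union> T \<rightarrow>\<^sub>E I. \<forall>j\<in>T. S (a j) \<inter> (\<Union>k\<in>D0. S (a k)) \<noteq> {}}"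

text \<open>A coordinate in \<open>D0\<close> costs a factor \<open>M + D\<close>; a coordinate in
  \<open>T\<close> has to meet the copies chosen before it and costs only \<open>D\<close>.\<close>

lemma sum_dominated_le:
  assumes ov: "overlap m D" and "finite D0" and "finite T" "T \<inter> D0 = {}" "card D0 + card T \<le> m"
  shows "(\<Sum>a\<in>dominated D0 T. p ^ card (\<Union>j\<in>D0 \<union> T. S (a j))) \<le> (M + D) ^ card D0 * D ^ card T"
  using assms(3-)
proof (induction T rule: finite_induct)
  case empty
  then show ?case using sum_tuples_le[OF ov assms(2)] by (simp add: dominated_def)
next
  case (insert j T)
  have fin: "finite (D0 \<union> T)" using insert.hyps assms(2) by simp
  have "(\<Sum>a\<in>dominated D0 (insert j T). p ^ card (\<Union>j\<in>insert j (D0 \<union> T). S (a j)))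
    \<le> D * (\<Sum>a\<in>dominated D0 T. p ^ card (\<Union>j\<in>D0 \<union> T. S (a j)))"
  proof (rule tuple_step[OF fin])
    fix a assume "a \<in> dominated D0 T"
    then have a: "a \<in> D0 \<union> T \<rightarrow>\<^sub>E I" by (simp add: dominated_def)
    let ?F = "\<Union>k\<in>D0 \<union> T. S (a k)"
    have "card (D0 \<union> T) \<le> m"
      using insert.prems insert.hyps card_Un_le[of D0 T] by simp
    then have F: "card ?F \<le> m * l"
      using card_UN_S_le[OF fin a] by (meson mult_le_mono1 order_trans)
    have "(\<Sum>i\<in>{i \<in> I. a(j := i) \<in> dominated D0 (insert j T)}. p ^ card (S i - ?F))
      \<le> (\<Sum>i\<in>{i\<in>I. S i \<inter> ?F \<noteq> {}}. p ^ card (S i - ?F))"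
    proof (rule sum_mono2)
      show "{i \<in> I. a(j := i) \<in> dominated D0 (insert j T)} \<subseteq> {i\<in>I. S i \<inter> ?F \<noteq> {}}"
      proof safe
        fix i assume "a(j := i) \<in> dominated D0 (insert j T)" and e: "S i \<inter> ?F = {}"
        then have "S i \<inter> (\<Union>k\<in>D0. S ((a(j := i)) k)) \<noteq> {}" by (force simp: dominated_def)
        moreover have "j \<notin> D0" using insert.prems by auto
        then have "(\<Union>k\<in>D0. S ((a(j := i)) k)) = (\<Union>k\<in>D0. S (a k))" by (intro SUP_cong) auto
        ultimately show False using e by blast
      qed
    qed (use finite_I p0 in auto)
    also have "\<dots> \<le> D" using ov UN_S_sub[OF a] F by (simp add: overlap_def)
    finally show "(\<Sum>i\<in>{i \<in> I. a(j := i) \<in> dominated D0 (insert j T)}. p ^ card (S i - ?F)) \<le> D" .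
  next
    fix b assume b: "b \<in> dominated D0 (insert j T)"
    then have "b \<in> insert j (D0 \<union> T) \<rightarrow>\<^sub>E I" by (simp add: dominated_def)
    then have 1: "restrict b (D0 \<union> T) \<in> D0 \<union> T \<rightarrow>\<^sub>E I" by auto
    show "restrict b (D0 \<union> T) \<in> dominated D0 T" 
      unfolding dominated_def using 1 b by (auto simp: dominated_def)
  qed (use insert in \<open>auto simp: dominated_def\<close>)
  also have "\<dots> \<le> D * ((M + D) ^ card D0 * D ^ card T)"
    using insert overlap_nonneg[OF ov] by (intro mult_left_mono) auto
  finally show ?case using insert.hyps by (simp add: mult_ac)
qed

text \<open>In \<open>16 ^ k\<close>, one factor \<open>4 ^ k\<close> comes from bounding
  \<open>2 * k\<close> centred indicators by \<open>ex_prod_Y\<close>, the other from the number of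
  candidates for the dominating set.\<close>

lemma moment_bound:
  assumes ov: "overlap (2 * k) D"
  shows "ex (\<lambda>E. W E ^ (2 * k)) \<le> (16 * ((M + D) * D)) ^ k"
proof -
  define T where "T = {..<2 * k}"
  have T: "finite T" "card T = 2 * k" by (auto simp: T_def)
  have D_nonneg: "0 \<le> D" and MD: "0 \<le> M + D" using overlap_nonneg[OF ov] M_nonneg by auto
  let ?iso = "\<lambda>a. \<exists>j0\<in>T. \<forall>j\<in>T. j \<noteq> j0 \<longrightarrow> S (a j) \<inter> S (a j0) = {}"
  let ?P = "\<lambda>a. p ^ card (\<Union>j\<in>T. S (a j))"
  let ?DD = "{D0 \<in> Pow T. 2 * card D0 \<le> card T}"
  have fin: "finite (T \<rightarrow>\<^sub>E I)" using T finite_I by (simp add: finite_PiE)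
  have findom: "finite (dominated D0 (T - D0))" if "D0 \<subseteq> T" for D0
  proof -
    have "D0 \<union> (T - D0) = T" using that by auto
    then show ?thesis using fin by (auto simp: dominated_def)
  qed
  have "ex (\<lambda>E. W E ^ (2 * k)) = ex (\<lambda>E. \<Sum>a\<in>T \<rightarrow>\<^sub>E I. \<Prod>j\<in>T. Y (a j) E)"
    using prod_sum_PiE[of T "\<lambda>_. I" "\<lambda>_ i. Y i E" for E] T finite_I
    by (intro ex_cong) (simp add: W_def)
  also have "\<dots> = (\<Sum>a\<in>T \<rightarrow>\<^sub>E I. ex (\<lambda>E. \<Prod>j\<in>T. Y (a j) E))" by (rule ex_sum)
  also have "\<dots> = (\<Sum>a\<in>{a \<in> T \<rightarrow>\<^sub>E I. \<not> ?iso a}. ex (\<lambda>E. \<Prod>j\<in>T. Y (a j) E))"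
  proof (rule sum.mono_neutral_right[OF fin])
    show "\<forall>a\<in>(T \<rightarrow>\<^sub>E I) - {a \<in> T \<rightarrow>\<^sub>E I. \<not> ?iso a}. ex (\<lambda>E. \<Prod>j\<in>T. Y (a j) E) = 0"
    proof
      fix a assume a: "a \<in> (T \<rightarrow>\<^sub>E I) - {a \<in> T \<rightarrow>\<^sub>E I. \<not> ?iso a}"
      then obtain j0 where "j0 \<in> T" "\<forall>j\<in>T. j \<noteq> j0 \<longrightarrow> S (a j) \<inter> S (a j0) = {}" by auto
      then show "ex (\<lambda>E. \<Prod>j\<in>T. Y (a j) E) = 0"
        using a T by (intro ex_prod_Y_isolated[where ?j0.0 = j0]) auto
    qed
  qed auto
  also have "\<dots> \<le> (\<Sum>a\<in>{a \<in> T \<rightarrow>\<^sub>E I. \<not> ?iso a}. 4 ^ k * ?P a)"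
  proof (rule sum_mono)
    fix a assume a: "a \<in> {a \<in> T \<rightarrow>\<^sub>E I. \<not> ?iso a}"
    have "\<bar>ex (\<lambda>E. \<Prod>j\<in>T. Y (a j) E)\<bar> \<le> 2 ^ card T * ?P a"
      using a T by (intro ex_prod_Y) auto
    then show "ex (\<lambda>E. \<Prod>j\<in>T. Y (a j) E) \<le> 4 ^ k * ?P a"
      using T by (simp add: power_mult)
  qed
  also have "\<dots> = 4 ^ k * (\<Sum>a\<in>{a \<in> T \<rightarrow>\<^sub>E I. \<not> ?iso a}. ?P a)" by (simp add: sum_distrib_left)
  also have "\<dots> \<le> 4 ^ k * (\<Sum>a\<in>(\<Union>D0\<in>?DD. dominated D0 (T - D0)). ?P a)"
  proof (intro mult_left_mono sum_mono2)
    show "finite (\<Union>D0\<in>?DD. dominated D0 (T - D0))" using T findom by auto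
    show "{a \<in> T \<rightarrow>\<^sub>E I. \<not> ?iso a} \<subseteq> (\<Union>D0\<in>?DD. dominated D0 (T - D0))"
    proof
      fix a assume a: "a \<in> {a \<in> T \<rightarrow>\<^sub>E I. \<not> ?iso a}"
      obtain D0 where D0: "D0 \<subseteq> T" "2 * card D0 \<le> card T"
        "\<And>v. v \<in> T - D0 \<Longrightarrow> \<exists>u\<in>D0. S (a v) \<inter> S (a u) \<noteq> {}"
      proof (rule dominating_set[of T "\<lambda>v u. S (a v) \<inter> S (a u) \<noteq> {}"])
        show "S (a y) \<inter> S (a x) \<noteq> {}" if "S (a x) \<inter> S (a y) \<noteq> {}" for x y
          using that by blast
        show "\<exists>u\<in>T. u \<noteq> v \<and> S (a v) \<inter> S (a u) \<noteq> {}" if "v \<in> T" for v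
          using a that by blast
      qed (use T in auto)
      have "D0 \<union> (T - D0) = T" using D0 by auto
      moreover have "S (a j) \<inter> (\<Union>k\<in>D0. S (a k)) \<noteq> {}" if "j \<in> T - D0" for j
        using D0(3)[OF that] by blast
      ultimately have "a \<in> dominated D0 (T - D0)" using a by (simp add: dominated_def)
      then show "a \<in> (\<Union>D0\<in>?DD. dominated D0 (T - D0))" using D0(1,2) by auto
    qed
  qed (use p0 in auto)
  also have "\<dots> \<le> 4 ^ k * (\<Sum>D0\<in>?DD. \<Sum>a\<in>dominated D0 (T - D0). ?P a)"
    using T p0 findom by (intro mult_left_mono sum_UN_le) auto
  also have "\<dots> \<le> 4 ^ k * (\<Sum>D0\<in>?DD. ((M + D) * D) ^ k)"
  proof (intro mult_left_mono sum_mono)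
    fix D0 assume D0: "D0 \<in> ?DD"
    then have fD0: "finite D0" using T finite_subset by auto
    have TD: "D0 \<union> (T - D0) = T" using D0 by auto
    have c: "card D0 + card (T - D0) = 2 * k" using D0 fD0 T
      by (metis (no_types, lifting) Diff_disjoint TD card_Un_disjoint finite_Diff)
    then have ck: "card D0 \<le> k" "k \<le> card (T - D0)" using D0 T by auto
    have "(\<Sum>a\<in>dominated D0 (T - D0). ?P a) \<le> (M + D) ^ card D0 * D ^ card (T - D0)"
      using sum_dominated_le[OF ov fD0, of "T - D0"] T c unfolding TD by auto
    also have "\<dots> \<le> ((M + D) * D) ^ k"
    proof -
      \<comment> \<open>Since \<open>card D0 \<le> k\<close>, the exponent of \<open>D\<close>
        exceeds \<open>k\<close> by \<open>r\<close>; these \<open>r\<close> extra factors are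
        bounded by \<open>M + D\<close>, which balances the two exponents.\<close>
      obtain r where r: "k = card D0 + r" using ck le_Suc_ex by blast
      have "(M + D) ^ card D0 * D ^ card (T - D0) = (M + D) ^ card D0 * D ^ k * D ^ r"
      proof -
        have e: "card (T - D0) = k + r" using c r by linarith
        show ?thesis unfolding e power_add by (simp only: mult_ac)
      qed
      also have "\<dots> \<le> (M + D) ^ card D0 * D ^ k * (M + D) ^ r"
        using MD D_nonneg M_nonneg by (intro mult_left_mono power_mono) auto
      also have "\<dots> = ((M + D) ^ card D0 * (M + D) ^ r) * D ^ k" by (simp only: mult_ac)
      also have "\<dots> = ((M + D) * D) ^ k"
        unfolding power_add[symmetric] r[symmetric] power_mult_distrib ..
      finally show ?thesis .
    qed
    finally show "(\<Sum>a\<in>dominated D0 (T - D0). ?P a) \<le> ((M + D) * D) ^ k" .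
  qed auto
  also have "\<dots> \<le> 4 ^ k * (4 ^ k * ((M + D) * D) ^ k)"
  proof -
    have "card ?DD \<le> card (Pow T)" using T by (intro card_mono) auto
    also have "\<dots> = 4 ^ k" using T by (simp add: card_Pow power_mult)
    finally have "real (card ?DD) \<le> 4 ^ k" by (metis of_nat_le_iff of_nat_numeral of_nat_power)
    then show ?thesis using MD D_nonneg by (intro mult_left_mono) (auto intro!: mult_right_mono)
  qed
  also have "\<dots> = (16 * ((M + D) * D)) ^ k"
    unfolding power_mult_distrib[symmetric] by simp
  finally show ?thesis .
qed

end

subsection \<open>Anticoncentration by Stein's method\<close>

text \<open>The difference contains the factor
  \<open>(y + x) / ((1 + x\<^sup>2) * (1 + y\<^sup>2))\<close>, which is at most 1 in absolute value
  because \<open>2 * \<bar>z\<bar> \<le> 1 + z\<^sup>2\<close>.\<close>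

lemma inverse_quadratic_lipschitz:
  fixes x y :: real
  shows "\<bar>1 / (1 + x\<^sup>2) - 1 / (1 + y\<^sup>2)\<bar> \<le> \<bar>x - y\<bar>"
proof -
  have two_abs: "2 * \<bar>z\<bar> \<le> 1 + z\<^sup>2" for z :: real
    using zero_le_power2[of "\<bar>z\<bar> - 1"] by (simp add: power2_diff)
  have half_sum: "(1 + u) / 2 + (1 + v) / 2 \<le> (1 + u) * (1 + v)" if "0 \<le> u" "0 \<le> v" for u v :: real
    using that mult_nonneg_nonneg[OF that] by (simp add: field_simps)
  have pos: "0 < 1 + x\<^sup>2" "0 < 1 + y\<^sup>2" by (auto simp: add_pos_nonneg)
  have "\<bar>y + x\<bar> \<le> \<bar>x\<bar> + \<bar>y\<bar>" by simp
  also have "\<dots> \<le> (1 + x\<^sup>2) / 2 + (1 + y\<^sup>2) / 2"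
    using two_abs by (intro add_mono) (simp_all add: mult.commute)
  also have "\<dots> \<le> (1 + x\<^sup>2) * (1 + y\<^sup>2)"
    by (rule half_sum) auto
  finally have b: "\<bar>y + x\<bar> \<le> (1 + x\<^sup>2) * (1 + y\<^sup>2)" .
  have "1 / (1 + x\<^sup>2) - 1 / (1 + y\<^sup>2) = (y - x) * ((y + x) / ((1 + x\<^sup>2) * (1 + y\<^sup>2)))"
    using pos by (simp add: field_simps power2_eq_square)
  also have "\<bar>\<dots>\<bar> = \<bar>x - y\<bar> * (\<bar>y + x\<bar> / ((1 + x\<^sup>2) * (1 + y\<^sup>2)))"
    using pos by (simp add: abs_mult abs_minus_commute)
  also have "\<dots> \<le> \<bar>x - y\<bar> * 1"
    using b pos by (intro mult_left_mono) (simp_all add: divide_le_eq)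
  finally show ?thesis by simp
qed

text \<open>\<open>g\<close> is the derivative of \<open>f\<close> and is Lipschitz with constant
  \<open>1 / s\<close>, so the mean value theorem gives a quadratic error for the linear
  approximation. The bound on \<open>f\<close> uses \<pi> / 2 < 2.\<close>

lemma scaled_arctan_taylor:
  fixes s :: real
  assumes s: "0 < s"
  defines "f \<equiv> \<lambda>x. s * arctan (x / s)" and "g \<equiv> \<lambda>x. 1 / (1 + (x / s)\<^sup>2)"
  shows "\<bar>g x - g y\<bar> \<le> \<bar>x - y\<bar> / s" "\<bar>f x - f y - (x - y) * g y\<bar> \<le> (x - y)\<^sup>2 / s" "\<bar>f x\<bar> \<le> 2 * s"
proof -
  have lip: "\<bar>g x - g y\<bar> \<le> \<bar>x - y\<bar> / s" for x y
    using inverse_quadratic_lipschitz[of "x / s" "y / s"] s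
    by (simp add: g_def diff_divide_distrib[symmetric])
  then show "\<bar>g x - g y\<bar> \<le> \<bar>x - y\<bar> / s" .
  have der: "(f has_real_derivative g x) (at x)" for x
    unfolding f_def g_def using s by (auto intro!: derivative_eq_intros simp: divide_inverse simp del: power_mult_distrib)
  have *: "\<exists>z. \<bar>z - y\<bar> \<le> \<bar>x - y\<bar> \<and> f x - f y = (x - y) * g z"
  proof -
    consider "x = y" | "x < y" | "y < x" by linarith
    then show ?thesis
    proof cases
      case 2
      then obtain z where "x < z" "z < y" "f y - f x = (y - x) * g z"
        using MVT2[of x y f g] der by blast
      then show ?thesis by (intro exI[of _ z]) (auto simp: algebra_simps)
    next
      case 3
      then obtain z where "y < z" "z < x" "f x - f y = (x - y) * g z"
        using MVT2[of y x f g] der by blast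
      then show ?thesis by (intro exI[of _ z]) auto
    qed auto
  qed
  then obtain z where z: "\<bar>z - y\<bar> \<le> \<bar>x - y\<bar>" "f x - f y = (x - y) * g z" by blast
  have "\<bar>f x - f y - (x - y) * g y\<bar> = \<bar>x - y\<bar> * \<bar>g z - g y\<bar>"
    unfolding z(2) by (simp add: abs_mult[symmetric] algebra_simps)
  also have "\<dots> \<le> \<bar>x - y\<bar> * (\<bar>x - y\<bar> / s)"
    using s by (intro mult_left_mono order_trans[OF lip[of z y] divide_right_mono[OF z(1)]]) auto
  finally show "\<bar>f x - f y - (x - y) * g y\<bar> \<le> (x - y)\<^sup>2 / s"
    by (simp add: power2_eq_square)
  have "\<bar>arctan (x / s)\<bar> \<le> 2" using arctan_bounded[of "x / s"] pi_less_4 by linarith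
  then show "\<bar>f x\<bar> \<le> 2 * s" using s by (simp add: f_def abs_mult)
qed

context copies
begin

definition near :: "'e set \<Rightarrow> 'i set" where "near A = {i\<in>I. S i \<inter> A \<noteq> {}}"

definition W_near :: "'e set \<Rightarrow> 'e set \<Rightarrow> real" where "W_near A E = (\<Sum>k\<in>near A. Y k E)"

lemma near_sub: "near A \<subseteq> I" and finite_near: "finite (near A)"
  using finite_I by (auto simp: near_def)

text \<open>Removing the copies that meet \<open>A\<close> leaves a sum that depends only on edges
  outside \<open>A\<close>, hence is independent of \<open>g\<close>.\<close>

lemma ex_indep_far:
  assumes A: "A \<subseteq> K" and g: "\<And>E. E \<subseteq> K \<Longrightarrow> g (E \<inter> A) = g E"
  shows "ex (\<lambda>E. g E * h (W E - W_near A E)) = ex g * ex (\<lambda>E. h (W E - W_near A E))"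
proof (rule bexp_indep[OF finite_K A])
  have "W E - W_near A E = (\<Sum>k\<in>I - near A. Y k E)" for E
    unfolding W_def W_near_def using near_sub finite_I by (simp add: sum_diff)
  then show "h (W (E - A) - W_near A (E - A)) = h (W E - W_near A E)" for E
    by (auto intro!: arg_cong[where f = h] sum.cong Y_depends' simp: near_def)
qed (rule g)

lemma power_diff_bound: "1 - p ^ l \<le> real l * (1 - p)"
  using Bernoulli_inequality[of "p - 1" l] p0 by (simp add: algebra_simps)

lemma ex_abs_Y: "i \<in> I \<Longrightarrow> ex (\<lambda>E. \<bar>Y i E\<bar>) \<le> 2 * real l * (1 - p)"
proof -
  assume i: "i \<in> I"
  have "ex (\<lambda>E. \<bar>Y i E\<bar>) = ex (\<lambda>E. (1 - 2 * p ^ l) * of_bool (S i \<subseteq> E) + p ^ l)"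
    using pl by (intro ex_cong) (auto simp: Y_def)
  also have "\<dots> = (1 - 2 * p ^ l) * p ^ l + p ^ l"
    unfolding ex_add ex_cmult ex_const using i by (simp add: bexp_subset finite_K S_sub card_S)
  also have "\<dots> = 2 * (p ^ l * (1 - p ^ l))" by (simp add: algebra_simps)
  also have "\<dots> \<le> 2 * (1 * (real l * (1 - p)))"
    using pl power_diff_bound by (intro mult_left_mono mult_mono) auto
  finally show ?thesis by simp
qed

text \<open>The summands serve the cases \<open>p \<le> 1 / 2\<close> and \<open>p > 1 / 2\<close>
  of \<open>third_order_bound\<close>.\<close>

definition stein_const :: real where "stein_const = 16 + 2 * real l * 8 ^ l"

lemma stein_const_pos: "0 < stein_const"
  by (simp add: stein_const_def add_pos_nonneg)

text \<open>Both small factors \<open>1 - p\<close> and \<open>p ^ c\<close> are wanted at once. One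
  of them is always bounded below: \<open>1 - p \<ge> 1 / 2\<close> in the first case, and
  \<open>p ^ c \<ge> 1 / 8 ^ l\<close> in the second, as \<open>c \<le> 3 * l\<close>.\<close>

lemma third_order_bound:
  assumes "q \<le> 8 * p ^ c" "q \<le> 2 * real l * (1 - p)" "c \<le> 3 * l"
  shows "q \<le> stein_const * (1 - p) * p ^ c"
proof (cases "p \<le> 1 / 2")
  case True
  have "8 * p ^ c \<le> 16 * (1 - p) * p ^ c"
    using True p0 by (intro mult_right_mono) auto
  also have "\<dots> \<le> stein_const * (1 - p) * p ^ c"
    using p0 p1 by (intro mult_right_mono) (auto simp: stein_const_def)
  finally show ?thesis using assms(1) by linarith
next
  case False
  have "1 = 8 ^ l * (1 / 2 :: real) ^ (3 * l)" by (simp add: power_mult power_one_over)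
  also have "\<dots> \<le> 8 ^ l * (1 / 2) ^ c"
    using assms(3) by (intro mult_left_mono power_decreasing) auto
  also have "\<dots> \<le> 8 ^ l * p ^ c" using False by (intro mult_left_mono power_mono) auto
  finally have "2 * real l * (1 - p) * 1 \<le> 2 * real l * (1 - p) * (8 ^ l * p ^ c)"
    using p1 by (intro mult_left_mono) auto
  also have "\<dots> = (2 * real l * 8 ^ l) * (1 - p) * p ^ c" by (simp only: mult_ac)
  also have "\<dots> \<le> stein_const * (1 - p) * p ^ c"
    unfolding stein_const_def using p0 p1 by (intro mult_right_mono) auto
  finally show ?thesis using assms(2) by linarith
qed

text \<open>These are the two kinds of error terms in \<open>stein_identity\<close>. Majorants of
  all three factors give \<open>8 * p ^ card (S i \<union> S j \<union> S k)\<close>, keeping a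
  single factor gives \<open>2 * real l * (1 - p)\<close>, and \<open>third_order_bound\<close>
  combines the two.\<close>

lemma ex_abs_YYY:
  assumes "i \<in> I" "j \<in> I" "k \<in> I"
  shows "ex (\<lambda>E. \<bar>Y i E * Y j E * Y k E\<bar>) \<le> stein_const * (1 - p) * p ^ card (S i \<union> S j \<union> S k)"
    and "ex (\<lambda>E. \<bar>Y i E * Y j E\<bar>) * ex (\<lambda>E. \<bar>Y k E\<bar>) \<le> stein_const * (1 - p) * p ^ card (S i \<union> S j \<union> S k)"
proof -
  let ?z = "\<lambda>i E. of_bool (S i \<subseteq> E) + p ^ l"
  have z: "0 \<le> ?z i E" for i E using pl by auto
  have sub: "S i \<subseteq> K" "S j \<subseteq> K" "S k \<subseteq> K" using S_sub assms by auto
  have base: "ex (\<lambda>E. of_bool (F \<subseteq> E) * 1) \<le> 1 * p ^ card (F \<union> {})" if "F \<subseteq> K" for F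
    using that by (simp add: bexp_subset finite_K)
  have b1: "ex (\<lambda>E. of_bool (F \<subseteq> E) * (?z k E * 1)) \<le> (2 * 1) * p ^ card (F \<union> (S k \<union> {}))"
    if "F \<subseteq> K" for F
    by (rule ex_of_bool_prod_step[OF assms(3) _ base]) (use that in auto)
  have b1': "ex (\<lambda>E. of_bool (F \<subseteq> E) * (?z j E * 1)) \<le> (2 * 1) * p ^ card (F \<union> (S j \<union> {}))"
    if "F \<subseteq> K" for F
    by (rule ex_of_bool_prod_step[OF assms(2) _ base]) (use that in auto)
  have b2: "ex (\<lambda>E. of_bool (F \<subseteq> E) * (?z j E * (?z k E * 1)))
      \<le> (2 * (2 * 1)) * p ^ card (F \<union> (S j \<union> (S k \<union> {})))" if "F \<subseteq> K" for F
    by (rule ex_of_bool_prod_step[OF assms(2) _ b1]) (use that sub in auto)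
  have b2': "ex (\<lambda>E. of_bool (F \<subseteq> E) * (?z i E * (?z j E * 1)))
      \<le> (2 * (2 * 1)) * p ^ card (F \<union> (S i \<union> (S j \<union> {})))" if "F \<subseteq> K" for F
    by (rule ex_of_bool_prod_step[OF assms(1) _ b1']) (use that sub in auto)
  have b3: "ex (\<lambda>E. of_bool ({} \<subseteq> E) * (?z i E * (?z j E * (?z k E * 1))))
      \<le> (2 * (2 * (2 * 1))) * p ^ card ({} \<union> (S i \<union> (S j \<union> (S k \<union> {}))))"
    by (rule ex_of_bool_prod_step[OF assms(1) _ b2]) (use sub in auto)
  have card3: "card (S i \<union> S j \<union> S k) \<le> 3 * l"
    using card_Un_le[of "S i \<union> S j" "S k"] card_Un_le[of "S i" "S j"] card_S assms by simp
  have "ex (\<lambda>E. \<bar>Y i E * Y j E * Y k E\<bar>) \<le> ex (\<lambda>E. of_bool ({} \<subseteq> E) * (?z i E * (?z j E * (?z k E * 1))))"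
    using Y_abs(2) z by (intro ex_mono) (simp add: abs_mult mult.assoc mult_mono)
  also note b3
  finally have 1: "ex (\<lambda>E. \<bar>Y i E * Y j E * Y k E\<bar>) \<le> 8 * p ^ card (S i \<union> S j \<union> S k)"
    by (simp add: Un_assoc)
  have "ex (\<lambda>E. \<bar>Y i E * Y j E * Y k E\<bar>) \<le> ex (\<lambda>E. \<bar>Y i E\<bar>)"
    using Y_abs(1) by (intro ex_mono) (simp add: abs_mult mult.assoc mult_left_le mult_le_one)
  then have 2: "ex (\<lambda>E. \<bar>Y i E * Y j E * Y k E\<bar>) \<le> 2 * real l * (1 - p)"
    using ex_abs_Y[OF assms(1)] by linarith
  show "ex (\<lambda>E. \<bar>Y i E * Y j E * Y k E\<bar>) \<le> stein_const * (1 - p) * p ^ card (S i \<union> S j \<union> S k)"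
    using third_order_bound[OF 1 2 card3] .
  have n: "0 \<le> ex (\<lambda>E. \<bar>Y i E * Y j E\<bar>)" "0 \<le> ex (\<lambda>E. \<bar>Y k E\<bar>)" by (auto intro: ex_nonneg)
  have "ex (\<lambda>E. \<bar>Y i E * Y j E\<bar>) \<le> ex (\<lambda>E. of_bool ({} \<subseteq> E) * (?z i E * (?z j E * 1)))"
    using Y_abs(2) z by (intro ex_mono) (simp add: abs_mult mult.assoc mult_mono)
  also note b2'[OF empty_subsetI]
  finally have 3: "ex (\<lambda>E. \<bar>Y i E * Y j E\<bar>) \<le> 4 * p ^ card (S i \<union> S j)" by simp
  have "ex (\<lambda>E. \<bar>Y k E\<bar>) \<le> ex (\<lambda>E. of_bool ({} \<subseteq> E) * (?z k E * 1))"
    using Y_abs(2) by (intro ex_mono) simp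
  also note b1[OF empty_subsetI]
  finally have 4: "ex (\<lambda>E. \<bar>Y k E\<bar>) \<le> 2 * p ^ card (S k)" by simp
  have "ex (\<lambda>E. \<bar>Y i E * Y j E\<bar>) * ex (\<lambda>E. \<bar>Y k E\<bar>) \<le> (4 * p ^ card (S i \<union> S j)) * (2 * p ^ card (S k))"
    using 3 4 n p0 by (intro mult_mono) auto
  also have "\<dots> = 8 * p ^ (card (S i \<union> S j) + card (S k))" by (simp add: power_add)
  also have "\<dots> \<le> 8 * p ^ card (S i \<union> S j \<union> S k)"
    using p0 p1 by (intro mult_left_mono power_decreasing card_Un_le) auto
  finally have 5: "ex (\<lambda>E. \<bar>Y i E * Y j E\<bar>) * ex (\<lambda>E. \<bar>Y k E\<bar>) \<le> 8 * p ^ card (S i \<union> S j \<union> S k)" .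
  have "ex (\<lambda>E. \<bar>Y i E * Y j E\<bar>) \<le> ex (\<lambda>_. 1)"
    using Y_abs(1) by (intro ex_mono) (simp add: abs_mult mult_le_one)
  then have "ex (\<lambda>E. \<bar>Y i E * Y j E\<bar>) * ex (\<lambda>E. \<bar>Y k E\<bar>) \<le> 1 * ex (\<lambda>E. \<bar>Y k E\<bar>)"
    using n by (intro mult_right_mono) (auto simp: ex_const)
  then have 6: "ex (\<lambda>E. \<bar>Y i E * Y j E\<bar>) * ex (\<lambda>E. \<bar>Y k E\<bar>) \<le> 2 * real l * (1 - p)"
    using ex_abs_Y[OF assms(3)] by linarith
  show "ex (\<lambda>E. \<bar>Y i E * Y j E\<bar>) * ex (\<lambda>E. \<bar>Y k E\<bar>) \<le> stein_const * (1 - p) * p ^ card (S i \<union> S j \<union> S k)"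
    using third_order_bound[OF 5 6 card3] .
qed

lemma card_union_diff: "finite A \<Longrightarrow> finite B \<Longrightarrow> card (A \<union> B) = card A + card (B - A)"
  by (metis Diff_disjoint Un_Diff_cancel card_Un_disjoint finite_Diff)

text \<open>Sum over \<open>k\<close>, then \<open>j\<close>, then \<open>i\<close>: each of the two
  inner sums costs a factor \<open>D\<close>. The largest set playing the role of \<open>F\<close>
  is \<open>S i \<union> S j\<close>, so \<open>overlap 2\<close> is enough.\<close>

lemma sum_overlap_triples:
  assumes ov: "overlap 2 D"
  shows "(\<Sum>i\<in>I. \<Sum>j\<in>near (S i). \<Sum>k\<in>near (S i \<union> S j). p ^ card (S i \<union> S j \<union> S k)) \<le> M * D\<^sup>2"
proof -
  have D: "0 \<le> D" using overlap_nonneg[OF ov] .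
  have near_sum: "(\<Sum>k\<in>near F. p ^ card (F \<union> S k)) \<le> p ^ card F * D" if F: "F \<subseteq> K" "card F \<le> 2 * l" for F
  proof -
    have "finite F" using F finite_K finite_subset by blast
    then have "(\<Sum>k\<in>near F. p ^ card (F \<union> S k)) = (\<Sum>k\<in>near F. p ^ card F * p ^ card (S k - F))"
      by (intro sum.cong refl) (auto simp: card_union_diff power_add finite_S subsetD[OF near_sub])
    also have "\<dots> \<le> p ^ card F * D"
      unfolding sum_distrib_left[symmetric] using ov F p0
      by (intro mult_left_mono) (auto simp: overlap_def near_def)
    finally show ?thesis .
  qed
  have cI: "card (S i \<union> S j) \<le> 2 * l" if "i \<in> I" "j \<in> I" for i j
    using card_Un_le[of "S i" "S j"] card_S that by simp
  have "(\<Sum>i\<in>I. \<Sum>j\<in>near (S i). \<Sum>k\<in>near (S i \<union> S j). p ^ card (S i \<union> S j \<union> S k))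
    \<le> (\<Sum>i\<in>I. \<Sum>j\<in>near (S i). p ^ card (S i \<union> S j) * D)"
    using near_sub S_sub cI by (intro sum_mono near_sum) blast+
  also have "\<dots> = (\<Sum>i\<in>I. (\<Sum>j\<in>near (S i). p ^ card (S i \<union> S j))) * D" by (simp add: sum_distrib_right)
  also have "\<dots> \<le> (\<Sum>i\<in>I. p ^ card (S i) * D) * D"
    using S_sub card_S D by (intro mult_right_mono sum_mono near_sum) auto
  also have "\<dots> = M * D\<^sup>2" by (simp add: M_def sum_distrib_right[symmetric] power2_eq_square)
  finally show ?thesis .
qed

text \<open>Copies that share no edge have zero covariance.\<close>

lemma ex_W_square: "ex (\<lambda>E. (W E)\<^sup>2) = (\<Sum>i\<in>I. \<Sum>j\<in>near (S i). ex (\<lambda>E. Y i E * Y j E))"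
proof -
  have "ex (\<lambda>E. (W E)\<^sup>2) = ex (\<lambda>E. \<Sum>i\<in>I. \<Sum>j\<in>I. Y i E * Y j E)"
    by (simp add: W_def power2_eq_square sum_product)
  also have "\<dots> = (\<Sum>i\<in>I. \<Sum>j\<in>I. ex (\<lambda>E. Y i E * Y j E))" by (simp add: ex_sum)
  also have "\<dots> = (\<Sum>i\<in>I. \<Sum>j\<in>near (S i). ex (\<lambda>E. Y i E * Y j E))"
  proof (rule sum.cong[OF refl], rule sum.mono_neutral_right, goal_cases)
    case (3 i)
    have "ex (\<lambda>E. Y i E * Y j E) = 0" if "j \<in> I - near (S i)" for j
    proof -
      have "ex (\<lambda>E. Y i E * Y j E) = ex (Y i) * ex (Y j)"
        using 3 that S_sub
        by (intro bexp_indep[OF finite_K, of "S i"] Y_depends Y_depends') (auto simp: near_def)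
      then show ?thesis using ex_Y 3 by simp
    qed
    then show ?case by blast
  qed (use finite_I near_sub in auto)
  finally show ?thesis .
qed

text \<open>The test function is \<open>f w = s arctan (w / s)\<close>, with derivative \<open>g\<close>: since \<open>\<bar>f\<bar> \<le> 2 s\<close> and \<open>g \<ge> 1/2\<close>
  on \<open>[-s, s]\<close>, the approximate identity \<open>ex (W f(W)) = ex (W\<^sup>2) ex (g(W))\<close> bounds the mass
  of \<open>W\<close> on \<open>[-s, s]\<close>.\<close>

lemma stein_identity:
  fixes s :: real
  assumes ov: "overlap 2 D" and s: "0 < s"
  defines "f \<equiv> \<lambda>x. s * arctan (x / s)" and "g \<equiv> \<lambda>x. 1 / (1 + (x / s)\<^sup>2)"
  shows "\<bar>ex (\<lambda>E. W E * f (W E)) - ex (\<lambda>E. (W E)\<^sup>2) * ex (\<lambda>E. g (W E))\<bar> \<le> 3 * stein_const * (1 - p) * M * D\<^sup>2 / s"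
proof -
  have tay: "\<bar>g x - g y\<bar> \<le> \<bar>x - y\<bar> / s" "\<bar>f x - f y - (x - y) * g y\<bar> \<le> (x - y)\<^sup>2 / s" for x y
    unfolding f_def g_def by (rule scaled_arctan_taylor[OF s])+
  let ?q = "\<lambda>i j k. stein_const * (1 - p) * p ^ card (S i \<union> S j \<union> S k) / s"
  have q0: "0 \<le> ?q i j k" for i j k using s p0 p1 stein_const_pos by simp
  \<comment> \<open>At the sum without the copies near \<open>S i\<close>, \<open>f\<close> is
    independent of the centred \<open>Y i\<close>, so that term vanishes. Expanding \<open>f\<close>
    around \<open>W E\<close> leaves \<open>Y i\<close> times the near sum times
    \<open>g (W E)\<close>, up to a remainder quadratic in the near sum.\<close>
  have first: "\<bar>ex (\<lambda>E. Y i E * f (W E)) - (\<Sum>j\<in>near (S i). ex (\<lambda>E. Y i E * Y j E * g (W E)))\<bar>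
      \<le> (\<Sum>j\<in>near (S i). \<Sum>k\<in>near (S i \<union> S j). ?q i j k)" if i: "i \<in> I" for i
  proof -
    let ?N = "W_near (S i)"
    have "ex (\<lambda>E. Y i E * f (W E - ?N E)) = ex (Y i) * ex (\<lambda>E. f (W E - ?N E))"
      using i S_sub by (intro ex_indep_far Y_depends) auto
    then have z: "ex (\<lambda>E. Y i E * f (W E - ?N E)) = 0" using ex_Y i by simp
    have e: "(\<Sum>j\<in>near (S i). ex (\<lambda>E. Y i E * Y j E * g (W E))) = ex (\<lambda>E. Y i E * (?N E * g (W E)))"
      unfolding ex_sum[symmetric] W_near_def by (simp add: sum_distrib_left sum_distrib_right mult.assoc)
    have "\<bar>ex (\<lambda>E. Y i E * f (W E)) - (\<Sum>j\<in>near (S i). ex (\<lambda>E. Y i E * Y j E * g (W E)))\<bar>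
      = \<bar>ex (\<lambda>E. Y i E * f (W E) - Y i E * f (W E - ?N E) - Y i E * (?N E * g (W E)))\<bar>"
      unfolding e ex_diff z by simp
    also have "\<dots> \<le> ex (\<lambda>E. \<bar>Y i E * f (W E) - Y i E * f (W E - ?N E) - Y i E * (?N E * g (W E))\<bar>)"
      by (rule ex_abs)
    also have "\<dots> \<le> ex (\<lambda>E. \<Sum>j\<in>near (S i). \<Sum>k\<in>near (S i). \<bar>Y i E * Y j E * Y k E\<bar> / s)"
    proof (rule ex_mono)
      fix E
      have "\<bar>Y i E * f (W E) - Y i E * f (W E - ?N E) - Y i E * (?N E * g (W E))\<bar>
        = \<bar>Y i E\<bar> * \<bar>f (W E - ?N E) - f (W E) - ((W E - ?N E) - W E) * g (W E)\<bar>"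
        unfolding abs_mult[symmetric] by (subst abs_minus_commute) (simp add: algebra_simps)
      also have "\<dots> \<le> \<bar>Y i E\<bar> * (((W E - ?N E) - W E)\<^sup>2 / s)"
        by (rule mult_left_mono[OF tay(2)]) simp
      also have "\<dots> = \<bar>Y i E\<bar> * \<bar>?N E\<bar> * \<bar>?N E\<bar> / s"
        by (simp add: power2_eq_square)
      also have "\<dots> \<le> \<bar>Y i E\<bar> * (\<Sum>j\<in>near (S i). \<bar>Y j E\<bar>) * (\<Sum>j\<in>near (S i). \<bar>Y j E\<bar>) / s"
        unfolding W_near_def using s
        by (intro divide_right_mono mult_mono sum_abs mult_nonneg_nonneg sum_nonneg) auto
      also have "\<dots> = (\<Sum>j\<in>near (S i). \<Sum>k\<in>near (S i). \<bar>Y i E * Y j E * Y k E\<bar> / s)"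
        unfolding mult.assoc sum_product abs_mult
        by (simp only: sum_distrib_left sum_divide_distrib)
      finally show "\<bar>Y i E * f (W E) - Y i E * f (W E - ?N E) - Y i E * (?N E * g (W E))\<bar>
        \<le> (\<Sum>j\<in>near (S i). \<Sum>k\<in>near (S i). \<bar>Y i E * Y j E * Y k E\<bar> / s)" .
    qed
    also have "\<dots> = (\<Sum>j\<in>near (S i). \<Sum>k\<in>near (S i). ex (\<lambda>E. \<bar>Y i E * Y j E * Y k E\<bar>) / s)"
      by (simp add: ex_sum ex_cdiv)
    also have "\<dots> \<le> (\<Sum>j\<in>near (S i). \<Sum>k\<in>near (S i). ?q i j k)"
      using s i near_sub by (intro sum_mono divide_right_mono ex_abs_YYY) auto
    \<comment> \<open>The range of \<open>k\<close> is enlarged so that these errors take the same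
      form as those in \<open>second\<close>.\<close>
    also have "\<dots> \<le> (\<Sum>j\<in>near (S i). \<Sum>k\<in>near (S i \<union> S j). ?q i j k)"
      using q0 finite_near by (intro sum_mono sum_mono2) (auto simp: near_def)
    finally show ?thesis .
  qed
  \<comment> \<open>\<open>g (W E)\<close> is decoupled from \<open>Y i E * Y j E\<close> by passing
    to the sum without the copies near \<open>S i \<union> S j\<close>. The passage is made once in
    the joint expectation and once in the product, hence the factor 2.\<close>
  have second: "\<bar>ex (\<lambda>E. Y i E * Y j E * g (W E)) - ex (\<lambda>E. Y i E * Y j E) * ex (\<lambda>E. g (W E))\<bar>
      \<le> (\<Sum>k\<in>near (S i \<union> S j). 2 * ?q i j k)" if ij: "i \<in> I" "j \<in> I" for i j
  proof -
    let ?A = "S i \<union> S j"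
    let ?N = "W_near ?A"
    let ?y = "\<lambda>E. Y i E * Y j E"
    have ind: "ex (\<lambda>E. ?y E * g (W E - ?N E)) = ex ?y * ex (\<lambda>E. g (W E - ?N E))"
    proof (rule ex_indep_far)
      show "?A \<subseteq> K" using ij S_sub by auto
      show "Y i (E \<inter> ?A) * Y j (E \<inter> ?A) = Y i E * Y j E" for E
        using ij Y_depends[of i ?A E] Y_depends[of j ?A E] by simp
    qed
    have gd: "\<bar>g (W E) - g (W E - ?N E)\<bar> \<le> (\<Sum>k\<in>near ?A. \<bar>Y k E\<bar>) / s" for E
    proof -
      have "\<bar>g (W E) - g (W E - ?N E)\<bar> \<le> \<bar>W E - (W E - ?N E)\<bar> / s" by (rule tay(1))
      also have "\<dots> \<le> (\<Sum>k\<in>near ?A. \<bar>Y k E\<bar>) / s"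
        using s by (intro divide_right_mono) (auto simp: W_near_def)
      finally show ?thesis .
    qed
    have "\<bar>ex (\<lambda>E. ?y E * (g (W E) - g (W E - ?N E)))\<bar> \<le> ex (\<lambda>E. \<bar>?y E * (g (W E) - g (W E - ?N E))\<bar>)"
      by (rule ex_abs)
    also have "\<dots> \<le> ex (\<lambda>E. \<Sum>k\<in>near ?A. \<bar>Y i E * Y j E * Y k E\<bar> / s)"
    proof (rule ex_mono)
      fix E
      have "\<bar>?y E * (g (W E) - g (W E - ?N E))\<bar> \<le> \<bar>?y E\<bar> * ((\<Sum>k\<in>near ?A. \<bar>Y k E\<bar>) / s)"
        unfolding abs_mult[of "?y E"] by (intro mult_left_mono gd) auto
      then show "\<bar>?y E * (g (W E) - g (W E - ?N E))\<bar> \<le> (\<Sum>k\<in>near ?A. \<bar>Y i E * Y j E * Y k E\<bar> / s)"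
        by (simp add: abs_mult sum_distrib_left sum_divide_distrib)
    qed
    also have "\<dots> = (\<Sum>k\<in>near ?A. ex (\<lambda>E. \<bar>Y i E * Y j E * Y k E\<bar>) / s)" by (simp add: ex_sum ex_cdiv)
    also have "\<dots> \<le> (\<Sum>k\<in>near ?A. ?q i j k)"
      using s ij near_sub by (intro sum_mono divide_right_mono ex_abs_YYY) auto
    finally have 1: "\<bar>ex (\<lambda>E. ?y E * (g (W E) - g (W E - ?N E)))\<bar> \<le> (\<Sum>k\<in>near ?A. ?q i j k)" .
    have "\<bar>ex ?y * ex (\<lambda>E. g (W E) - g (W E - ?N E))\<bar>
      \<le> ex (\<lambda>E. \<bar>?y E\<bar>) * ex (\<lambda>E. (\<Sum>k\<in>near ?A. \<bar>Y k E\<bar>) / s)"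
      unfolding abs_mult[of "ex ?y"] using gd
      by (intro mult_mono ex_abs order_trans[OF ex_abs] ex_mono ex_nonneg) auto
    also have "\<dots> = (\<Sum>k\<in>near ?A. ex (\<lambda>E. \<bar>?y E\<bar>) * ex (\<lambda>E. \<bar>Y k E\<bar>) / s)"
      by (simp add: ex_sum ex_cdiv sum_distrib_left sum_divide_distrib)
    also have "\<dots> \<le> (\<Sum>k\<in>near ?A. ?q i j k)"
      using s ij near_sub by (intro sum_mono divide_right_mono ex_abs_YYY) auto
    finally have 2: "\<bar>ex ?y * ex (\<lambda>E. g (W E) - g (W E - ?N E))\<bar> \<le> (\<Sum>k\<in>near ?A. ?q i j k)" .
    have "ex (\<lambda>E. ?y E * g (W E)) - ex ?y * ex (\<lambda>E. g (W E))
      = ex (\<lambda>E. ?y E * (g (W E) - g (W E - ?N E))) - ex ?y * ex (\<lambda>E. g (W E) - g (W E - ?N E))"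
      by (simp add: ex_diff ind right_diff_distrib)
    then show ?thesis using 1 2 unfolding sum_distrib_left[symmetric] by linarith
  qed
  let ?Q = "\<Sum>i\<in>I. \<Sum>j\<in>near (S i). \<Sum>k\<in>near (S i \<union> S j). ?q i j k"
  have WfW: "ex (\<lambda>E. W E * f (W E)) = (\<Sum>i\<in>I. ex (\<lambda>E. Y i E * f (W E)))"
    unfolding ex_sum[symmetric] by (simp add: W_def sum_distrib_right)
  have "\<bar>ex (\<lambda>E. W E * f (W E)) - (\<Sum>i\<in>I. \<Sum>j\<in>near (S i). ex (\<lambda>E. Y i E * Y j E * g (W E)))\<bar> \<le> ?Q"
    unfolding WfW sum_subtractf[symmetric]
    by (intro order_trans[OF sum_abs] sum_mono first)
  moreover have "\<bar>(\<Sum>i\<in>I. \<Sum>j\<in>near (S i). ex (\<lambda>E. Y i E * Y j E * g (W E)))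
       - ex (\<lambda>E. (W E)\<^sup>2) * ex (\<lambda>E. g (W E))\<bar> \<le> (\<Sum>i\<in>I. \<Sum>j\<in>near (S i). \<Sum>k\<in>near (S i \<union> S j). 2 * ?q i j k)"
    unfolding ex_W_square sum_distrib_right sum_subtractf[symmetric]
    using near_sub by (intro order_trans[OF sum_abs] sum_mono second) auto
  moreover have "(\<Sum>i\<in>I. \<Sum>j\<in>near (S i). \<Sum>k\<in>near (S i \<union> S j). 2 * ?q i j k) = 2 * ?Q"
    by (simp only: sum_distrib_left)
  ultimately have "\<bar>ex (\<lambda>E. W E * f (W E)) - ex (\<lambda>E. (W E)\<^sup>2) * ex (\<lambda>E. g (W E))\<bar> \<le> 3 * ?Q" by linarith
  also have "?Q = stein_const * (1 - p) / s *
      (\<Sum>i\<in>I. \<Sum>j\<in>near (S i). \<Sum>k\<in>near (S i \<union> S j). p ^ card (S i \<union> S j \<union> S k))"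
    by (simp add: sum_distrib_left)
  also have "3 * \<dots> \<le> 3 * (stein_const * (1 - p) / s * (M * D\<^sup>2))"
    using s p1 stein_const_pos by (intro mult_left_mono sum_overlap_triples[OF ov]) auto
  also have "\<dots> = 3 * stein_const * (1 - p) * M * D\<^sup>2 / s"
    by (simp only: times_divide_eq_left times_divide_eq_right mult.assoc)
  finally show ?thesis .
qed

text \<open>The first error term arises because the mean of \<open>W E * f (W E)\<close> is at most
  \<open>2 * s\<close> times the mean of \<open>\<bar>W E\<bar>\<close>, which is at most the
  standard deviation.\<close>

lemma anticoncentration:
  assumes ov: "overlap 2 D" and s: "0 < s"
  shows "ex (\<lambda>E. (W E)\<^sup>2) / 2 * ex (\<lambda>E. of_bool (\<bar>W E\<bar> \<le> s))
    \<le> 2 * s * sqrt (ex (\<lambda>E. (W E)\<^sup>2)) + 3 * stein_const * (1 - p) * M * D\<^sup>2 / s"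
proof -
  define f where "f = (\<lambda>x. s * arctan (x / s))"
  define g where "g = (\<lambda>x. 1 / (1 + (x / s)\<^sup>2))"
  let ?v = "ex (\<lambda>E. (W E)\<^sup>2)"
  have v: "0 \<le> ?v" by (rule ex_nonneg) simp
  have "of_bool (\<bar>w\<bar> \<le> s) \<le> 2 * g w" for w
  proof (cases "\<bar>w\<bar> \<le> s")
    case True
    have "(w / s)\<^sup>2 = \<bar>w / s\<bar>\<^sup>2" by (rule power2_abs[symmetric])
    also have "\<dots> \<le> 1\<^sup>2" using True s by (intro power_mono) auto
    finally have "1 + (w / s)\<^sup>2 \<le> 2" by simp
    then show ?thesis using True by (simp add: g_def le_divide_eq add_pos_nonneg)
  qed (simp add: g_def)
  then have "ex (\<lambda>E. of_bool (\<bar>W E\<bar> \<le> s)) \<le> 2 * ex (\<lambda>E. g (W E))"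
    unfolding ex_cmult[symmetric] by (intro ex_mono)
  then have "?v / 2 * ex (\<lambda>E. of_bool (\<bar>W E\<bar> \<le> s)) \<le> ?v / 2 * (2 * ex (\<lambda>E. g (W E)))"
    using v by (intro mult_left_mono) auto
  also have "\<dots> = ?v * ex (\<lambda>E. g (W E))" by simp
  also have "\<dots> \<le> ex (\<lambda>E. W E * f (W E)) + 3 * stein_const * (1 - p) * M * D\<^sup>2 / s"
    using stein_identity[OF ov s] unfolding f_def g_def by linarith
  also have "ex (\<lambda>E. W E * f (W E)) \<le> ex (\<lambda>E. 2 * s * \<bar>W E\<bar>)"
  proof (rule ex_mono)
    fix E
    have "W E * f (W E) \<le> \<bar>W E\<bar> * \<bar>f (W E)\<bar>" unfolding abs_mult[symmetric] by simp
    also have "\<dots> \<le> \<bar>W E\<bar> * (2 * s)"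
      using scaled_arctan_taylor(3)[OF s] by (intro mult_left_mono) (auto simp: f_def)
    finally show "W E * f (W E) \<le> 2 * s * \<bar>W E\<bar>" by (simp add: mult_ac)
  qed
  also have "\<dots> = 2 * s * ex (\<lambda>E. \<bar>W E\<bar>)" by (simp add: ex_cmult)
  also have "\<dots> \<le> 2 * s * sqrt ?v"
    using s ex_abs_sq[of W] by (intro mult_left_mono real_le_rsqrt) auto
  finally show ?thesis by simp
qed

text \<open>By Cauchy-Schwarz, at least \<open>(card I)\<^sup>2 / B\<close> pairs \<open>i\<close>, \<open>j\<close> have \<open>T i = T j\<close>.\<close>

lemma variance_lower_bound:
  assumes T: "\<And>i. i \<in> I \<Longrightarrow> T i \<subseteq> S i" "\<And>i. i \<in> I \<Longrightarrow> card (T i) = r" and r: "0 < r"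
    and B: "card (T ` I) \<le> B"
  shows "(card I * p ^ l)\<^sup>2 * (1 - p) \<le> B * p ^ r * ex (\<lambda>E. (W E)\<^sup>2)"
proof -
  have cov: "ex (\<lambda>E. Y i E * Y j E) = p ^ card (S i \<union> S j) - p ^ (2 * l)" if "i \<in> I" "j \<in> I" for i j
  proof -
    have un: "ex (\<lambda>E. of_bool (S i \<union> S j \<subseteq> E)) = p ^ card (S i \<union> S j)"
      using that S_sub by (intro bexp_subset finite_K) auto
    have "ex (\<lambda>E. Y i E * Y j E) = ex (\<lambda>E. of_bool (S i \<union> S j \<subseteq> E) - p ^ l * of_bool (S i \<subseteq> E)
        - p ^ l * of_bool (S j \<subseteq> E) + p ^ l * p ^ l)"
      by (rule ex_cong) (auto simp: Y_def algebra_simps)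
    also have "\<dots> = p ^ card (S i \<union> S j) - p ^ (2 * l)"
      unfolding ex_add ex_diff ex_cmult ex_const mult_2 power_add un using that
      by (simp add: bexp_subset[OF finite_K] S_sub card_S)
    finally show ?thesis .
  qed
  have le2l: "card (S i \<union> S j) \<le> 2 * l" if "i \<in> I" "j \<in> I" for i j
    using card_Un_le[of "S i" "S j"] card_S that by simp
  \<comment> \<open>Copies with the same \<open>T\<close> share at least \<open>r\<close> edges, so
    their union has at most \<open>2 * l - r\<close> edges. As \<open>r > 0\<close>, the subtracted
    power \<open>p ^ (2 * l)\<close> has an exponent larger by at least 1, which yields the factor
    \<open>1 - p\<close>.\<close>
  have shared: "p ^ (2 * l - r) * (1 - p) \<le> ex (\<lambda>E. Y i E * Y j E)"
    if ij: "i \<in> I" "j \<in> I" "T i = T j" for i j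
  proof -
    have "T i \<subseteq> S i \<inter> S j" using T(1)[OF ij(1)] T(1)[OF ij(2)] ij(3) by auto
    then have q: "r \<le> card (S i \<inter> S j)"
      using T(2)[OF ij(1)] finite_S[OF ij(1)] by (metis card_mono finite_Int)
    have u: "card (S i \<union> S j) + card (S i \<inter> S j) = 2 * l"
      using card_Un_Int[of "S i" "S j"] finite_S card_S ij by simp
    let ?u = "card (S i \<union> S j)"
    have "p ^ (2 * l - r) * (1 - p) \<le> p ^ ?u * (1 - p)"
      using p0 p1 q u by (intro mult_right_mono power_decreasing) auto
    also have "\<dots> = p ^ ?u - p ^ (?u + 1)" by (simp add: algebra_simps)
    also have "\<dots> \<le> p ^ ?u - p ^ (2 * l)"
      using p0 p1 q u r by (intro diff_left_mono power_decreasing) auto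
    finally show ?thesis using cov ij by simp
  qed
  have nonneg: "0 \<le> ex (\<lambda>E. Y i E * Y j E)" if "i \<in> I" "j \<in> I" for i j
    unfolding cov[OF that] using power_decreasing[OF le2l[OF that] p0 p1] by simp
  let ?c = "\<lambda>t. card {i \<in> I. T i = t}"
  have "real (card I) = (\<Sum>t\<in>T ` I. real (?c t))"
    using sum.image_gen[OF finite_I, of "\<lambda>_. 1::real" T] by simp
  then have "(real (card I))\<^sup>2 \<le> (\<Sum>t\<in>T ` I. (real (?c t))\<^sup>2) * card (T ` I)"
    using sum_squared_le_sum_of_squares[of "\<lambda>t. real (?c t)" "T ` I"] finite_I by simp
  also have "\<dots> \<le> (\<Sum>t\<in>T ` I. (real (?c t))\<^sup>2) * B"
    using B by (intro mult_left_mono sum_nonneg) auto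
  also have "(\<Sum>t\<in>T ` I. (real (?c t))\<^sup>2) = (\<Sum>i\<in>I. real (?c (T i)))"
    using sum.image_gen[OF finite_I, of "\<lambda>i. real (?c (T i))" T]
    by (simp add: power2_eq_square)
  finally have pairs: "(real (card I))\<^sup>2 \<le> B * (\<Sum>i\<in>I. real (?c (T i)))" by (simp add: mult.commute)
  have "ex (\<lambda>E. (W E)\<^sup>2) = ex (\<lambda>E. \<Sum>i\<in>I. \<Sum>j\<in>I. Y i E * Y j E)"
    by (simp add: W_def power2_eq_square sum_product)
  also have "\<dots> = (\<Sum>i\<in>I. \<Sum>j\<in>I. ex (\<lambda>E. Y i E * Y j E))" by (simp add: ex_sum)
  also have "\<dots> \<ge> (\<Sum>i\<in>I. \<Sum>j\<in>{j\<in>I. T j = T i}. ex (\<lambda>E. Y i E * Y j E))"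
    using nonneg finite_I by (intro sum_mono sum_mono2) auto
  also have "(\<Sum>i\<in>I. \<Sum>j\<in>{j\<in>I. T j = T i}. ex (\<lambda>E. Y i E * Y j E))
    \<ge> (\<Sum>i\<in>I. \<Sum>j\<in>{j\<in>I. T j = T i}. p ^ (2 * l - r) * (1 - p))"
    using shared by (intro sum_mono) auto
  finally have var: "p ^ (2 * l - r) * (1 - p) * (\<Sum>i\<in>I. real (?c (T i))) \<le> ex (\<lambda>E. (W E)\<^sup>2)"
    by (simp add: sum_distrib_left mult.commute)
  show ?thesis
  proof (cases "I = {}")
    case True
    then show ?thesis using ex_nonneg[of "\<lambda>E. (W E)\<^sup>2"] p0 by simp
  next
    case False
    then obtain i where i: "i \<in> I" by auto
    have "r \<le> l" using T[OF i] card_mono[OF finite_S[OF i] T(1)[OF i]] card_S[OF i] by simp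
    then have e: "(p ^ l)\<^sup>2 = p ^ r * p ^ (2 * l - r)"
      unfolding power_mult[symmetric] power_add[symmetric] by (simp add: mult.commute)
    have "(card I * p ^ l)\<^sup>2 * (1 - p) = p ^ r * (p ^ (2 * l - r) * (1 - p)) * (real (card I))\<^sup>2"
      unfolding power_mult_distrib e by (simp only: mult_ac)
    also have "\<dots> \<le> p ^ r * (p ^ (2 * l - r) * (1 - p)) * (B * (\<Sum>i\<in>I. real (?c (T i))))"
      using p0 p1 pairs by (intro mult_left_mono) auto
    also have "\<dots> = B * p ^ r * (p ^ (2 * l - r) * (1 - p) * (\<Sum>i\<in>I. real (?c (T i))))"
      by (simp only: mult_ac)
    also have "\<dots> \<le> B * p ^ r * ex (\<lambda>E. (W E)\<^sup>2)"
      using p0 var by (intro mult_left_mono) auto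
    finally show ?thesis .
  qed
qed

end

subsection \<open>Copies of a rooted graph\<close>

lemma finite_Kn_edges: "finite (Kn_edges n)"
  unfolding Kn_edges_def by (rule finite_subset[of _ "Pow {1..n}"]) auto

lemma pmf_Gnp:
  assumes "0 \<le> p" "p \<le> 1" and E: "E \<subseteq> Kn_edges n"
  shows "pmf (Gnp n p) E = p ^ card E * (1 - p) ^ card (Kn_edges n - E)"
proof -
  let ?K = "Kn_edges n"
  let ?P = "Pi_pmf ?K False (\<lambda>_. bernoulli_pmf p)"
  have "pmf (Gnp n p) E = measure_pmf.prob ?P ((\<lambda>f. {e \<in> ?K. f e}) -` {E})"
    unfolding Gnp_def by (rule pmf_map)
  \<comment> \<open>Functions that differ from the default \<open>False\<close> outside
    \<open>?K\<close> have probability zero, so the preimage of \<open>{E}\<close> may be replaced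
    by a single function.\<close>
  also have "\<dots> = measure_pmf.prob ?P {\<lambda>e. e \<in> E}"
    by (rule measure_prob_cong_0) (use E in \<open>auto simp: pmf_Pi finite_Kn_edges fun_eq_iff\<close>)
  also have "\<dots> = (\<Prod>e\<in>?K. pmf (bernoulli_pmf p) (e \<in> E))"
    unfolding measure_pmf_single using E by (subst pmf_Pi') (auto simp: finite_Kn_edges)
  also have "\<dots> = (\<Prod>e\<in>?K. if e \<in> E then p else 1 - p)"
    using assms by (intro prod.cong) auto
  also have "\<dots> = (\<Prod>e\<in>E. p) * (\<Prod>e\<in>?K - E. 1 - p)"
    using E by (subst prod.If_cases[OF finite_Kn_edges]) (auto simp: Int_absorb1 Diff_eq)
  finally show ?thesis by simp
qed

lemma expectation_Gnp:
  assumes "0 \<le> p" "p \<le> 1"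
  shows "measure_pmf.expectation (Gnp n p) g = bexp (Kn_edges n) p g"
proof -
  have "measure_pmf.expectation (Gnp n p) g = (\<Sum>E\<in>Pow (Kn_edges n). g E * pmf (Gnp n p) E)"
    by (rule integral_measure_pmf_real) (auto simp: finite_Kn_edges Gnp_def)
  also have "\<dots> = bexp (Kn_edges n) p g"
    unfolding bexp_def by (intro sum.cong) (auto simp: pmf_Gnp[OF assms])
  finally show ?thesis .
qed

lemma prob_Gnp:
  assumes "0 \<le> p" "p \<le> 1"
  shows "measure_pmf.prob (Gnp n p) {E. P E} = bexp (Kn_edges n) p (\<lambda>E. of_bool (P E))"
proof -
  have "measure_pmf.prob (Gnp n p) {E. P E} = measure_pmf.expectation (Gnp n p) (indicator {E. P E})"
    by simp
  also have "(indicator {E. P E} :: _ \<Rightarrow> real) = (\<lambda>E. of_bool (P E))"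
    by (auto simp: indicator_def)
  finally show ?thesis using expectation_Gnp[OF assms] by simp
qed

section \<open>Embeddings and the number of copies\<close>

definition embeddings :: "nat \<Rightarrow> nat \<Rightarrow> nat set \<Rightarrow> nat list \<Rightarrow> (nat \<Rightarrow> nat) set" where
  "embeddings n vG VH xs =
     {\<phi>. inj_on \<phi> VH \<and> \<phi> ` VH \<subseteq> {1..n} \<and> (\<forall>j\<in>{1..vG}. \<phi> j = xs ! (j - 1))}"

definition new_edges :: "nat \<Rightarrow> nat set set \<Rightarrow> nat set set" where
  "new_edges vG EH = EH - root_edges vG EH"

text \<open>Several embeddings can give the same copy, and values outside \<open>VH\<close> do not
  affect it; hence copies are counted as images of embeddings, matching the subgraph count in
  \<open>ext_count\<close>.\<close>

definition copy_of :: "nat \<Rightarrow> nat set \<Rightarrow> nat set set \<Rightarrow> (nat \<Rightarrow> nat) \<Rightarrow> nat set \<times> nat set set" where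
  "copy_of vG VH EH \<phi> = (\<phi> ` VH, (\<lambda>e. \<phi> ` e) ` new_edges vG EH)"

definition ext_copies :: "nat \<Rightarrow> nat \<Rightarrow> nat set \<Rightarrow> nat set set \<Rightarrow> nat list \<Rightarrow> (nat set \<times> nat set set) set" where
  "ext_copies n vG VH EH xs = copy_of vG VH EH ` embeddings n vG VH xs"

locale rooted =
  fixes vG :: nat and VH :: "nat set" and EH :: "nat set set"
  assumes rg: "rooted_graph vG VH EH"
begin

abbreviation "E' \<equiv> new_edges vG EH"
abbreviation "U \<equiv> VH - {1..vG}"
abbreviation "l \<equiv> card E'"
abbreviation "v \<equiv> card U"
abbreviation "cps n xs \<equiv> ext_copies n vG VH EH xs"

lemma rgD: "finite VH" "{1..vG} \<subseteq> VH" "e \<in> EH \<Longrightarrow> e \<subseteq> VH" "e \<in> EH \<Longrightarrow> card e = 2"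
  "card (root_edges vG EH) < card EH"
  using rg by (auto simp: rooted_graph_def)

lemma finite_EH: "finite EH"
  using rgD(5) card.infinite by fastforce

lemma finite_E': "finite E'" and E'_sub: "E' \<subseteq> EH" and finite_U: "finite U"
  using finite_EH rgD(1) by (auto simp: new_edges_def)

lemma E'D: "e \<in> E' \<Longrightarrow> e \<subseteq> VH" "e \<in> E' \<Longrightarrow> card e = 2" "e \<in> E' \<Longrightarrow> \<not> e \<subseteq> {1..vG}"
  using rgD(3,4) by (auto simp: new_edges_def root_edges_def)

lemma l_pos: "0 < l"
proof -
  have "root_edges vG EH \<subseteq> EH" by (auto simp: root_edges_def)
  then have "l = card EH - card (root_edges vG EH)"
    unfolding new_edges_def using finite_EH finite_subset by (intro card_Diff_subset) auto
  then show ?thesis using rgD(5) by simp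
qed

lemma v_pos: "0 < v"
proof -
  obtain e where "e \<in> E'" using l_pos by fastforce
  then have "U \<noteq> {}" using E'D by blast
  then show ?thesis using finite_U by (simp add: card_gt_0_iff)
qed

lemma card_VH: "card VH = vG + v"
proof -
  have "card ({1..vG} \<union> U) = vG + v"
    using finite_U by (subst card_Un_disjoint) auto
  moreover have "{1..vG} \<union> U = VH" using rgD(2) by auto
  ultimately show ?thesis by simp
qed

lemma inj_on_edges: "\<phi> \<in> embeddings n vG VH xs \<Longrightarrow> inj_on (\<lambda>e. \<phi> ` e) E'"
  unfolding embeddings_def using E'D(1)
  by (intro inj_on_subset[OF inj_on_image_Pow[of \<phi> VH]]) auto

lemma snd_copy_of: "snd (copy_of vG VH EH \<phi>) = (\<lambda>e. \<phi> ` e) ` E'"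
  by (simp add: copy_of_def)

lemma copy_of_cong:
  assumes "\<And>u. u \<in> VH \<Longrightarrow> \<phi> u = \<psi> u"
  shows "copy_of vG VH EH \<phi> = copy_of vG VH EH \<psi>"
proof -
  have "\<phi> ` e = \<psi> ` e" if "e \<subseteq> VH" for e
    by (rule image_cong[OF refl]) (use assms that in blast)
  then show ?thesis using E'D(1) unfolding copy_of_def by (metis (no_types, lifting) image_cong order_refl)
qed

lemma copy_sub:
  assumes "\<phi> \<in> embeddings n vG VH xs" "A \<subseteq> E'"
  shows "(\<lambda>e. \<phi> ` e) ` A \<subseteq> Kn_edges n"
proof
  fix x assume "x \<in> (\<lambda>e. \<phi> ` e) ` A"
  then obtain e where e: "e \<in> E'" "x = \<phi> ` e" using assms(2) by auto
  have "inj_on \<phi> e" using assms(1) E'D(1)[OF e(1)] by (auto simp: embeddings_def intro: inj_on_subset)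
  then have "card x = 2" using E'D(2)[OF e(1)] e(2) card_image by fastforce
  then show "x \<in> Kn_edges n" using assms(1) E'D(1)[OF e(1)] e(2) by (auto simp: embeddings_def Kn_edges_def)
qed

lemma finite_cps: "finite (cps n xs)"
proof (rule finite_subset)
  show "cps n xs \<subseteq> Pow {1..n} \<times> Pow (Kn_edges n)"
  proof
    fix c assume "c \<in> cps n xs"
    then obtain \<phi> where \<phi>: "\<phi> \<in> embeddings n vG VH xs" "c = copy_of vG VH EH \<phi>"
      by (auto simp: ext_copies_def)
    then show "c \<in> Pow {1..n} \<times> Pow (Kn_edges n)"
      using copy_sub[OF \<phi>(1) order_refl] unfolding copy_of_def embeddings_def by blast
  qed
qed (simp add: finite_Kn_edges)

lemma copies_ext: "0 \<le> p \<Longrightarrow> p \<le> 1 \<Longrightarrow> copies (Kn_edges n) p (cps n xs) snd l"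
proof unfold_locales
  show "finite (Kn_edges n)" by (rule finite_Kn_edges)
  show "finite (cps n xs)" by (rule finite_cps)
  fix c assume "c \<in> cps n xs"
  then obtain \<phi> where \<phi>: "\<phi> \<in> embeddings n vG VH xs" "c = copy_of vG VH EH \<phi>"
    by (auto simp: ext_copies_def)
  show "snd c \<subseteq> Kn_edges n" using copy_sub[OF \<phi>(1) order_refl] \<phi>(2) snd_copy_of by simp
  show "card (snd c) = l" using card_image[OF inj_on_edges[OF \<phi>(1)]] \<phi>(2) snd_copy_of by simp
qed

lemma X_ext_eq: "X_ext n vG VH EH xs E = (\<Sum>c\<in>cps n xs. of_bool (snd c \<subseteq> E))"
proof -
  have "{(\<phi> ` VH, (\<lambda>e. \<phi> ` e) ` (EH - root_edges vG EH)) | \<phi>.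
        inj_on \<phi> VH \<and> \<phi> ` VH \<subseteq> {1..n} \<and> (\<forall>j\<in>{1..vG}. \<phi> j = xs ! (j - 1)) \<and>
        (\<forall>e \<in> EH - root_edges vG EH. \<phi> ` e \<in> E)} = {c \<in> cps n xs. snd c \<subseteq> E}"
    unfolding ext_copies_def copy_of_def embeddings_def new_edges_def by (auto simp: image_subset_iff)
  then show ?thesis
    unfolding X_ext_def ext_count_def using finite_cps
    by (simp add: of_bool_def sum.If_cases Int_def conj_commute)
qed

lemma mu_ext_eq:
  fixes p :: real
  assumes "0 \<le> p" "p \<le> 1"
  shows "mu_ext n p vG VH EH = card (cps n [1..<vG+1]) * p ^ l"
proof -
  interpret C: copies "Kn_edges n" p "cps n [1..<vG+1]" snd l by (rule copies_ext[OF assms])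
  have "mu_ext n p vG VH EH = C.ex (\<lambda>E. \<Sum>c\<in>cps n [1..<vG+1]. of_bool (snd c \<subseteq> E))"
    unfolding mu_ext_def expectation_Gnp[OF assms] X_ext_eq ..
  also have "\<dots> = (\<Sum>c\<in>cps n [1..<vG+1]. p ^ l)"
    unfolding C.ex_sum by (intro sum.cong refl) (simp add: bexp_subset finite_Kn_edges C.S_sub C.card_S)
  finally show ?thesis by simp
qed

text \<open>The roots are prescribed, so the values of an embedding on the non-root vertices
  determine the copy.\<close>

lemma card_cps_le: "card (cps n xs) \<le> n ^ v"
proof -
  let ?r = "\<lambda>f u. if u \<in> {1..vG} then xs ! (u - 1) else f u"
  have "cps n xs \<subseteq> (\<lambda>f. copy_of vG VH EH (?r f)) ` (U \<rightarrow>\<^sub>E {1..n})"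
  proof
    fix c assume "c \<in> cps n xs"
    then obtain \<phi> where \<phi>: "\<phi> \<in> embeddings n vG VH xs" "c = copy_of vG VH EH \<phi>"
      by (auto simp: ext_copies_def)
    have eq: "?r (restrict \<phi> U) u = \<phi> u" if "u \<in> VH" for u
      using that \<phi>(1) by (auto simp: embeddings_def)
    have "c = copy_of vG VH EH (?r (restrict \<phi> U))"
      unfolding \<phi>(2) by (rule copy_of_cong[OF eq, symmetric])
    moreover have "restrict \<phi> U \<in> U \<rightarrow>\<^sub>E {1..n}" using \<phi>(1) by (auto simp: embeddings_def)
    ultimately show "c \<in> (\<lambda>f. copy_of vG VH EH (?r f)) ` (U \<rightarrow>\<^sub>E {1..n})" by (rule image_eqI)
  qed
  then have "card (cps n xs) \<le> card (U \<rightarrow>\<^sub>E {1..n})"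
    by (rule surj_card_le[rotated]) (use finite_U in \<open>simp add: finite_PiE\<close>)
  also have "\<dots> = n ^ v" using finite_U by (simp add: card_PiE)
  finally show ?thesis .
qed

text \<open>The \<open>j\<close>-th non-root vertex is sent to one of the \<open>b\<close> vertices congruent to \<open>j\<close> modulo \<open>v\<close>,
  so that the vertex set of the copy determines the embedding.\<close>

lemma card_cps_ge:
  assumes b: "vG + v * b \<le> n"
  shows "b ^ v \<le> card (cps n [1..<vG+1])"
proof -
  obtain idx where idx: "bij_betw idx U {0..<v}" using ex_bij_betw_finite_nat[OF finite_U] by blast
  have idx_less: "idx u < v" if "u \<in> U" for u using bij_betwE[OF idx] that by auto
  have idx_inj: "u = u'" if "u \<in> U" "u' \<in> U" "idx u = idx u'" for u u'
    using idx that by (auto simp: bij_betw_def dest: inj_onD)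
  \<comment> \<open>The offset \<open>vG + 1\<close> keeps the images clear of the roots. The number
    \<open>idx u + v * h u\<close> can be decoded: its residue modulo \<open>v\<close> gives
    \<open>u\<close>, its quotient gives \<open>h u\<close>.\<close>
  define \<phi> where "\<phi> h u = (if u \<in> {1..vG} then u else vG + 1 + (idx u + v * h u))" for h :: "nat \<Rightarrow> nat" and u
  have decode: "u = u' \<and> h u = h' u'"
    if "u \<in> U" "u' \<in> U" "idx u + v * h u = idx u' + v * h' u'" for u u' and h h' :: "nat \<Rightarrow> nat"
  proof -
    have "(idx u + v * h u) mod v = (idx u' + v * h' u') mod v" using that(3) by simp
    then have "u = u'" using idx_less that idx_inj by simp
    then show ?thesis using that v_pos by simp
  qed
  have emb: "\<phi> h \<in> embeddings n vG VH [1..<vG+1]" if h: "h \<in> U \<rightarrow>\<^sub>E {0..<b}" for h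
    unfolding embeddings_def
  proof (intro CollectI conjI ballI)
    show "inj_on (\<phi> h) VH"
    proof (rule inj_onI)
      fix u u' assume u: "u \<in> VH" "u' \<in> VH" "\<phi> h u = \<phi> h u'"
      show "u = u'"
        using u decode[of u u' h h] by (auto simp: \<phi>_def split: if_splits)
    qed
    show "\<phi> h ` VH \<subseteq> {1..n}"
    proof (rule image_subsetI)
      fix u assume u: "u \<in> VH"
      show "\<phi> h u \<in> {1..n}"
      proof (cases "u \<in> {1..vG}")
        case True
        then show ?thesis using b by (auto simp: \<phi>_def)
      next
        case False
        then have uU: "u \<in> U" using u by auto
        then have "h u < b" using h by auto
        then have "v * (h u + 1) \<le> v * b" by (intro mult_le_mono2) auto
        then have "idx u + v * h u < v * b" using idx_less[OF uU] by simp
        then show ?thesis using False b by (auto simp: \<phi>_def)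
      qed
    qed
    fix j assume "j \<in> {1..vG}"
    then show "\<phi> h j = [1..<vG + 1] ! (j - 1)" by (auto simp: \<phi>_def simp del: upt_Suc)
  qed
  have "inj_on (\<lambda>h. copy_of vG VH EH (\<phi> h)) (U \<rightarrow>\<^sub>E {0..<b})"
  proof (rule inj_onI)
    fix h h' assume h: "h \<in> U \<rightarrow>\<^sub>E {0..<b}" "h' \<in> U \<rightarrow>\<^sub>E {0..<b}"
      and eq: "copy_of vG VH EH (\<phi> h) = copy_of vG VH EH (\<phi> h')"
    show "h = h'"
    proof (rule PiE_ext[OF h])
      fix u assume u: "u \<in> U"
      have "\<phi> h u \<in> \<phi> h' ` VH" using eq u by (auto simp: copy_of_def)
      then obtain u' where u': "u' \<in> VH" "\<phi> h u = \<phi> h' u'" by auto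
      then have "u' \<in> U" "idx u + v * h u = idx u' + v * h' u'"
        using u by (auto simp: \<phi>_def split: if_splits)
      then show "h u = h' u" using decode[OF u, of u' h h'] by auto
    qed
  qed
  then have "card (U \<rightarrow>\<^sub>E {0..<b}) \<le> card (cps n [1..<vG+1])"
    using emb by (intro card_inj_on_le[OF _ _ finite_cps]) (auto simp: ext_copies_def)
  then show ?thesis using finite_U by (simp add: card_PiE)
qed

lemma card_cps_lower:
  assumes n: "2 * card VH \<le> n"
  shows "real n ^ v \<le> (2 * v) ^ v * card (cps n [1..<vG+1])"
proof -
  define b where "b = (n - vG) div v"
  have "v * b \<le> n - vG" unfolding b_def by (rule times_div_less_eq_dividend)
  then have b: "vG + v * b \<le> n" using n card_VH by linarith
  have "n - vG < v * (b + 1)"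
    unfolding b_def using v_pos by (metis add.commute dividend_less_times_div mult_Suc_right plus_1_eq_Suc)
  \<comment> \<open>The hypothesis gives \<open>vG + v \<le> n / 2\<close>, which absorbs both the
    roots and the rounding in \<open>b\<close>.\<close>
  then have "n \<le> 2 * v * b" using n card_VH by simp
  then have "n ^ v \<le> (2 * v * b) ^ v" by (intro power_mono) auto
  also have "\<dots> = (2 * v) ^ v * b ^ v" by (simp add: power_mult_distrib)
  also have "\<dots> \<le> (2 * v) ^ v * card (cps n [1..<vG+1])"
    using card_cps_ge[OF b] by (intro mult_left_mono) auto
  finally show ?thesis by (metis of_nat_le_iff of_nat_mult of_nat_power)
qed

end

section \<open>Independence of the choice of the root tuple\<close>

lemma tuples_permutation:
  assumes xs: "xs \<in> tuples n k" and ys: "ys \<in> tuples n k"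
  obtains \<pi> where "bij_betw \<pi> {1..n} {1..n}" "\<And>i. i < k \<Longrightarrow> \<pi> (xs ! i) = ys ! i"
proof -
  have X: "length xs = k" "distinct xs" "set xs \<subseteq> {1..n}" and Y: "length ys = k" "distinct ys" "set ys \<subseteq> {1..n}"
    using xs ys by (auto simp: tuples_def)
  have bx: "bij_betw (nth xs) {..<k} (set xs)" and bij_y: "bij_betw (nth ys) {..<k} (set ys)"
    using X Y by (auto intro: bij_betw_nth)
  define h where "h = nth ys \<circ> inv_into {..<k} (nth xs)"
  have h: "bij_betw h (set xs) (set ys)"
    unfolding h_def by (rule bij_betw_trans[OF bij_betw_inv_into[OF bx] bij_y])
  have h_nth: "h (xs ! i) = ys ! i" if "i < k" for i
    using bij_betw_inv_into_left[OF bx, of i] that by (simp add: h_def)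
  have "card ({1..n} - set xs) = card ({1..n} - set ys)"
    using X Y by (simp add: card_Diff_subset distinct_card)
  then obtain g where g: "bij_betw g ({1..n} - set xs) ({1..n} - set ys)"
    using finite_same_card_bij[of "{1..n} - set xs" "{1..n} - set ys"] by auto
  define \<pi> where "\<pi> x = (if x \<in> set xs then h x else g x)" for x
  have "bij_betw \<pi> (set xs) (set ys)"
    using h by (rule bij_betw_cong[THEN iffD1, rotated]) (simp add: \<pi>_def)
  moreover have "bij_betw \<pi> ({1..n} - set xs) ({1..n} - set ys)"
    using g by (rule bij_betw_cong[THEN iffD1, rotated]) (simp add: \<pi>_def)
  ultimately have "bij_betw \<pi> (set xs \<union> ({1..n} - set xs)) (set ys \<union> ({1..n} - set ys))"
    by (rule bij_betw_combine) auto
  moreover have "set xs \<union> ({1..n} - set xs) = {1..n}" "set ys \<union> ({1..n} - set ys) = {1..n}"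
    using X Y by auto
  ultimately have "bij_betw \<pi> {1..n} {1..n}" by simp
  then show thesis using that h_nth X by (metis \<pi>_def nth_mem)
qed

lemma initial_tuple: "k \<le> n \<Longrightarrow> [1..<k + 1] \<in> tuples n k"
  by (auto simp: tuples_def)

lemma finite_tuples: "finite (tuples n k)" and card_tuples_le: "card (tuples n k) \<le> n ^ k"
proof -
  have sub: "tuples n k \<subseteq> {xs. set xs \<subseteq> {1..n} \<and> length xs = k}" by (auto simp: tuples_def)
  have fin: "finite {xs. set xs \<subseteq> {1..n} \<and> length xs = k}" by (rule finite_lists_length_eq) simp
  show "finite (tuples n k)" by (rule finite_subset[OF sub fin])
  show "card (tuples n k) \<le> n ^ k" using card_mono[OF fin sub] card_lists_length_eq[of "{1..n}" k] by simp
qed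

context rooted
begin

text \<open>A permutation of \<open>{1..n}\<close> that takes \<open>xs\<close> to \<open>ys\<close>
  maps copies rooted at \<open>xs\<close> injectively to copies rooted at \<open>ys\<close>.
  Exchanging the tuples gives equality.\<close>

lemma card_cps_mono:
  assumes xs: "xs \<in> tuples n vG" and ys: "ys \<in> tuples n vG"
  shows "card (cps n xs) \<le> card (cps n ys)"
proof -
  obtain \<pi> where \<pi>: "bij_betw \<pi> {1..n} {1..n}" "\<And>i. i < vG \<Longrightarrow> \<pi> (xs ! i) = ys ! i"
    using tuples_permutation[OF assms] by blast
  have inj: "inj_on \<pi> {1..n}" using \<pi>(1) by (simp add: bij_betw_def)
  let ?f = "\<lambda>(V, S). (\<pi> ` V, (\<lambda>e. \<pi> ` e) ` S)"
  have sub: "cps n xs \<subseteq> Pow {1..n} \<times> Pow (Pow {1..n})"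
    using E'D(1) by (fastforce simp: ext_copies_def copy_of_def embeddings_def)
  have "inj_on (image \<pi>) (Pow {1..n})" by (rule inj_on_image_Pow[OF inj])
  moreover from this have "inj_on (image (image \<pi>)) (Pow (Pow {1..n}))" by (rule inj_on_image_Pow)
  ultimately have "inj_on ?f (Pow {1..n} \<times> Pow (Pow {1..n}))"
    by (auto simp: inj_on_def)
  then have "inj_on ?f (cps n xs)" using sub by (rule inj_on_subset)
  moreover have "?f ` cps n xs \<subseteq> cps n ys"
  proof
    fix c assume "c \<in> ?f ` cps n xs"
    then obtain \<phi> where \<phi>: "\<phi> \<in> embeddings n vG VH xs" "c = ?f (copy_of vG VH EH \<phi>)"
      unfolding ext_copies_def by blast
    have "\<pi> ` {1..n} = {1..n}" using \<pi>(1) by (simp add: bij_betw_def)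
    then have "\<pi> \<circ> \<phi> \<in> embeddings n vG VH ys"
      using \<phi>(1) inj \<pi>(2) by (auto simp: embeddings_def image_subset_iff intro!: comp_inj_on intro: inj_on_subset)
    moreover have "c = copy_of vG VH EH (\<pi> \<circ> \<phi>)"
      using \<phi>(2) by (simp add: copy_of_def image_comp comp_def image_image)
    ultimately show "c \<in> cps n ys" by (simp add: ext_copies_def)
  qed
  ultimately show ?thesis by (rule card_inj_on_le[OF _ _ finite_cps])
qed

lemma card_cps_eq:
  assumes "xs \<in> tuples n vG" "vG \<le> n"
  shows "card (cps n xs) = card (cps n [1..<vG+1])"
  by (intro antisym card_cps_mono assms initial_tuple)

section \<open>Rooted subgraphs and the minimum \<Phi>\<close>

definition sub_rooted :: "nat set \<Rightarrow> nat set set \<Rightarrow> bool" where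
  "sub_rooted VJ EJ \<longleftrightarrow> {1..vG} \<subseteq> VJ \<and> VJ \<subseteq> VH \<and> root_edges vG EH \<subseteq> EJ \<and> EJ \<subseteq> EH \<and>
      (\<forall>e\<in>EJ. e \<subseteq> VJ) \<and> card (root_edges vG EH) < card EJ"

text \<open>An admissible subgraph keeps all root edges of H, so it is a rooted graph with the same
  root edges, and the counting results apply to it too.\<close>

lemma sub_rooted_rooted:
  assumes "sub_rooted VJ EJ"
  shows "rooted vG VJ EJ" "new_edges vG EJ \<subseteq> E'"
proof -
  have eq: "root_edges vG EJ = root_edges vG EH"
    using assms by (auto simp: sub_rooted_def root_edges_def)
  show "rooted vG VJ EJ"
    using assms rgD(1,4) finite_subset unfolding rooted_def rooted_graph_def eq sub_rooted_def by blast
  show "new_edges vG EJ \<subseteq> E'" using assms eq by (auto simp: new_edges_def sub_rooted_def)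
qed

lemma sub_rooted_self: "sub_rooted VH EH"
  using rgD by (auto simp: sub_rooted_def root_edges_def)

lemma
  shows Phi_le: "sub_rooted VJ EJ \<Longrightarrow> Phi_ext n p vG VH EH \<le> mu_ext n p vG VJ EJ"
    and Phi_attained: "\<exists>VJ EJ. sub_rooted VJ EJ \<and> Phi_ext n p vG VH EH = mu_ext n p vG VJ EJ"
proof -
  let ?A = "{(VJ, EJ). sub_rooted VJ EJ}"
  let ?B = "(\<lambda>(VJ, EJ). mu_ext n p vG VJ EJ) ` ?A"
  have "?A \<subseteq> Pow VH \<times> Pow EH" by (auto simp: sub_rooted_def)
  then have "finite ?A" by (rule finite_subset) (simp add: rgD(1) finite_EH)
  then have fin: "finite ?B" by (rule finite_imageI)
  have Phi: "Phi_ext n p vG VH EH = Min ?B"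
    unfolding Phi_ext_def sub_rooted_def by (rule arg_cong[where f = Min]) auto
  show "sub_rooted VJ EJ \<Longrightarrow> Phi_ext n p vG VH EH \<le> mu_ext n p vG VJ EJ"
    unfolding Phi using fin by (intro Min_le) auto
  have "?B \<noteq> {}" using sub_rooted_self by auto
  then have "Min ?B \<in> ?B" by (rule Min_in[OF fin])
  then show "\<exists>VJ EJ. sub_rooted VJ EJ \<and> Phi_ext n p vG VH EH = mu_ext n p vG VJ EJ"
    unfolding Phi by auto
qed

text \<open>This compares \<open>\<Phi>\<close> with the expected count of the subgraph spanned by the roots and \<open>A\<close>.\<close>

lemma Phi_le_spanned:
  assumes A: "A \<subseteq> E'" "A \<noteq> {}" and p: "0 \<le> p" "p \<le> 1"
  shows "real n ^ (v - card (\<Union>A - {1..vG})) * p ^ (l - card A) * Phi_ext n p vG VH EH \<le> real n ^ v * p ^ l"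
proof -
  define VJ where "VJ = {1..vG} \<union> \<Union>A"
  define EJ where "EJ = root_edges vG EH \<union> A"
  have fin: "finite A" "finite (root_edges vG EH)"
    using A finite_E' finite_EH finite_subset by (auto simp: root_edges_def)
  have disj: "root_edges vG EH \<inter> A = {}" using A by (auto simp: new_edges_def)
  have "card EJ = card (root_edges vG EH) + card A"
    unfolding EJ_def by (rule card_Un_disjoint[OF fin(2,1) disj])
  then have "card (root_edges vG EH) < card EJ" using A fin by (simp add: card_gt_0_iff)
  moreover have "VJ \<subseteq> VH" using rgD(2) A E'D(1) by (fastforce simp: VJ_def)
  ultimately have J: "sub_rooted VJ EJ"
    using A E'_sub by (auto simp: sub_rooted_def VJ_def EJ_def root_edges_def)
  interpret J: rooted vG VJ EJ by (rule sub_rooted_rooted(1)[OF J])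
  have newJ: "new_edges vG EJ = A" using A by (auto simp: new_edges_def EJ_def root_edges_def)
  have UJ: "VJ - {1..vG} = \<Union>A - {1..vG}" by (auto simp: VJ_def)
  have le: "card (\<Union>A - {1..vG}) \<le> v" "card A \<le> l"
    using \<open>VJ \<subseteq> VH\<close> A finite_U finite_E' UJ by (auto intro!: card_mono simp: VJ_def)
  have "Phi_ext n p vG VH EH \<le> mu_ext n p vG VJ EJ" by (rule Phi_le[OF J])
  also have "\<dots> \<le> real n ^ card (\<Union>A - {1..vG}) * p ^ card A"
  proof -
    have "card (J.cps n [1..<vG+1]) \<le> n ^ card (\<Union>A - {1..vG})"
      using J.card_cps_le unfolding UJ .
    then have "real (card (J.cps n [1..<vG+1])) \<le> real n ^ card (\<Union>A - {1..vG})"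
      by (metis of_nat_le_iff of_nat_power)
    then show ?thesis
      unfolding J.mu_ext_eq[OF p] newJ using p by (intro mult_right_mono) auto
  qed
  finally have "real n ^ (v - card (\<Union>A - {1..vG})) * p ^ (l - card A) * Phi_ext n p vG VH EH
    \<le> real n ^ (v - card (\<Union>A - {1..vG})) * p ^ (l - card A) * (real n ^ card (\<Union>A - {1..vG}) * p ^ card A)"
    using p by (intro mult_left_mono) auto
  also have "\<dots> = (real n ^ (v - card (\<Union>A - {1..vG})) * real n ^ card (\<Union>A - {1..vG})) * (p ^ (l - card A) * p ^ card A)"
    by (simp only: mult_ac)
  also have "\<dots> = real n ^ v * p ^ l"
    using le by (simp add: power_add[symmetric])
  finally show ?thesis .
qed

text \<open>Copies meeting \<open>F\<close> are classified by the nonempty set \<open>A\<close> of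
  edges of H sent into \<open>F\<close>; there are at most \<open>2 ^ l\<close> such patterns. The
  non-root endpoints of \<open>A\<close> must land among the at most \<open>2 * m * l\<close>
  endpoints of \<open>F\<close>, the other vertices are free, and \<open>Phi_le_spanned\<close>
  bounds the resulting product of powers of \<open>n\<close> and \<open>p\<close>.\<close>

lemma overlap_copies:
  assumes p: "0 \<le> p" "p \<le> 1" and m: "1 \<le> m" and Phi: "0 < Phi_ext n p vG VH EH"
  shows "copies.overlap (Kn_edges n) p (cps n xs) snd l m
    (2 ^ l * (2 * m * l) ^ v * (real n ^ v * p ^ l / Phi_ext n p vG VH EH))"
proof -
  interpret C: copies "Kn_edges n" p "cps n xs" snd l by (rule copies_ext[OF p])
  let ?Q = "real n ^ v * p ^ l / Phi_ext n p vG VH EH"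
  show ?thesis
    unfolding C.overlap_def
  proof (intro allI impI)
    fix F assume F: "F \<subseteq> Kn_edges n" "card F \<le> m * l"
    have finF: "finite F" using F(1) finite_Kn_edges finite_subset by auto
    have UF: "\<Union>F \<subseteq> {1..n}" using F(1) by (auto simp: Kn_edges_def)
    then have finUF: "finite (\<Union>F)" using finite_subset by blast
    have "card (\<Union>F) \<le> sum card F" by (rule card_Union_le_sum_card)
    also have "\<dots> = (\<Sum>e\<in>F. 2)" using F(1) by (intro sum.cong) (auto simp: Kn_edges_def)
    also have "\<dots> \<le> 2 * m * l" using F(2) by simp
    finally have cUF: "card (\<Union>F) \<le> 2 * m * l" .
    \<comment> \<open>Different embeddings of one copy may have different patterns, so the classes
      \<open>B A\<close> may overlap; for an upper bound a cover is enough.\<close>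
    define B where "B A = {c \<in> cps n xs. \<exists>\<phi>\<in>embeddings n vG VH xs.
        c = copy_of vG VH EH \<phi> \<and> A = {e \<in> E'. \<phi> ` e \<in> F}}" for A
    have finB: "finite (B A)" for A using finite_cps by (simp add: B_def)
    have term_eq: "p ^ card (snd c - F) = p ^ (l - card A)" if cB: "c \<in> B A" for c A
    proof -
      obtain \<phi> where \<phi>: "\<phi> \<in> embeddings n vG VH xs" "c = copy_of vG VH EH \<phi>" "A = {e \<in> E'. \<phi> ` e \<in> F}"
        using cB unfolding B_def by blast
      have "snd c - F = (\<lambda>e. \<phi> ` e) ` (E' - A)" using \<phi>(2,3) by (auto simp: snd_copy_of)
      moreover have "card ((\<lambda>e. \<phi> ` e) ` (E' - A)) = card (E' - A)"
        by (rule card_image) (rule inj_on_subset[OF inj_on_edges[OF \<phi>(1)]], auto)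
      moreover have "card (E' - A) = l - card A"
        using \<phi>(3) finite_E' by (intro card_Diff_subset) auto
      ultimately show ?thesis by simp
    qed
    have cardB: "card (B A) \<le> (2 * m * l) ^ v * n ^ (v - card (\<Union>A - {1..vG}))" if A: "A \<subseteq> E'" for A
    proof -
      let ?r = "\<lambda>f u. if u \<in> {1..vG} then xs ! (u - 1) else f u"
      let ?P = "\<Pi>\<^sub>E u\<in>U. if u \<in> \<Union>A then \<Union>F else {1..n}"
      have finP: "finite ?P" using finite_U finUF by (intro finite_PiE) auto
      have "B A \<subseteq> (\<lambda>f. copy_of vG VH EH (?r f)) ` ?P"
      proof
        fix c assume "c \<in> B A"
        then obtain \<phi> where \<phi>: "\<phi> \<in> embeddings n vG VH xs" "c = copy_of vG VH EH \<phi>" "A = {e \<in> E'. \<phi> ` e \<in> F}"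
          unfolding B_def by blast
        have eq: "?r (restrict \<phi> U) u = \<phi> u" if "u \<in> VH" for u
          using that \<phi>(1) by (auto simp: embeddings_def)
        have "c = copy_of vG VH EH (?r (restrict \<phi> U))"
          unfolding \<phi>(2) by (rule copy_of_cong[OF eq, symmetric])
        moreover have "restrict \<phi> U \<in> ?P"
        proof (rule restrict_PiE_iff[THEN iffD2], rule ballI)
          fix u assume "u \<in> U"
          then show "\<phi> u \<in> (if u \<in> \<Union>A then \<Union>F else {1..n})"
            using \<phi>(1,3) by (auto simp: embeddings_def)
        qed
        ultimately show "c \<in> (\<lambda>f. copy_of vG VH EH (?r f)) ` ?P" by (rule image_eqI)
      qed
      then have "card (B A) \<le> card ?P" by (rule surj_card_le[OF finP])
      also have "card ?P = (\<Prod>u\<in>U. if u \<in> \<Union>A then card (\<Union>F) else n)"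
        using finite_U by (subst card_PiE) (auto intro!: prod.cong)
      also have "\<dots> = card (\<Union>F) ^ card (U \<inter> \<Union>A) * n ^ card (U \<inter> - \<Union>A)"
        unfolding prod.If_cases[OF finite_U] Collect_mem_eq by simp
      also have "U \<inter> \<Union>A = \<Union>A - {1..vG}" using A E'D(1) by auto
      also have "card (U \<inter> - \<Union>A) = v - card (\<Union>A - {1..vG})"
      proof -
        have "U \<inter> - \<Union>A = U - (\<Union>A - {1..vG})" by auto
        moreover have "\<Union>A - {1..vG} \<subseteq> U" using A E'D(1) by auto
        ultimately show ?thesis using finite_U finite_subset by (metis card_Diff_subset)
      qed
      also have "card (\<Union>F) ^ card (\<Union>A - {1..vG}) \<le> (2 * m * l) ^ card (\<Union>A - {1..vG})"
        using cUF by (rule power_mono) simp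
      also have "\<dots> \<le> (2 * m * l) ^ v"
      proof (rule power_increasing)
        show "card (\<Union>A - {1..vG}) \<le> v" using A E'D(1) finite_U by (intro card_mono) auto
        show "1 \<le> 2 * m * l" using m l_pos by simp
      qed
      finally show ?thesis by simp
    qed
    let ?N = "{c \<in> cps n xs. snd c \<inter> F \<noteq> {}}"
    have "(\<Sum>c\<in>?N. p ^ card (snd c - F)) \<le> (\<Sum>c\<in>(\<Union>A\<in>Pow E' - {{}}. B A). p ^ card (snd c - F))"
    proof (rule sum_mono2)
      show "finite (\<Union>A\<in>Pow E' - {{}}. B A)" using finite_E' finB by auto
      show "?N \<subseteq> (\<Union>A\<in>Pow E' - {{}}. B A)"
      proof
        fix c assume c: "c \<in> ?N"
        then obtain \<phi> where \<phi>: "\<phi> \<in> embeddings n vG VH xs" "c = copy_of vG VH EH \<phi>"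
          by (auto simp: ext_copies_def)
        have "c \<in> B {e \<in> E'. \<phi> ` e \<in> F}" using c \<phi> by (auto simp: B_def)
        moreover have "{e \<in> E'. \<phi> ` e \<in> F} \<in> Pow E' - {{}}" using c \<phi>(2) by (auto simp: snd_copy_of)
        ultimately show "c \<in> (\<Union>A\<in>Pow E' - {{}}. B A)" by (rule UN_I[rotated])
      qed
    qed (use p in auto)
    also have "\<dots> \<le> (\<Sum>A\<in>Pow E' - {{}}. \<Sum>c\<in>B A. p ^ card (snd c - F))"
      using finite_E' finB p by (intro sum_UN_le) auto
    also have "\<dots> \<le> (\<Sum>A\<in>Pow E' - {{}}. (2 * m * l) ^ v * ?Q)"
    proof (rule sum_mono)
      fix A assume A: "A \<in> Pow E' - {{}}"
      have "(\<Sum>c\<in>B A. p ^ card (snd c - F)) = card (B A) * p ^ (l - card A)"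
        using term_eq by simp
      also have "\<dots> \<le> ((2 * m * l) ^ v * n ^ (v - card (\<Union>A - {1..vG}))) * p ^ (l - card A)"
      proof (rule mult_right_mono)
        show "real (card (B A)) \<le> real ((2 * m * l) ^ v * n ^ (v - card (\<Union>A - {1..vG})))"
          using cardB A by (subst of_nat_le_iff) auto
      qed (use p in simp)
      also have "\<dots> = (2 * m * l) ^ v * (real n ^ (v - card (\<Union>A - {1..vG})) * p ^ (l - card A))" by simp
      also have "\<dots> \<le> (2 * m * l) ^ v * ?Q"
        using Phi_le_spanned[of A p n] A p Phi
        by (intro mult_left_mono) (auto simp: pos_le_divide_eq)
      finally show "(\<Sum>c\<in>B A. p ^ card (snd c - F)) \<le> (2 * m * l) ^ v * ?Q" .
    qed
    also have "\<dots> = card (Pow E' - {{}}) * ((2 * m * l) ^ v * ?Q)" by simp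
    also have "\<dots> \<le> 2 ^ l * ((2 * m * l) ^ v * ?Q)"
    proof (rule mult_right_mono)
      have "card (Pow E' - {{}}) \<le> card (Pow E')" using finite_E' by (intro card_mono) auto
      also have "\<dots> = 2 ^ l" using finite_E' by (simp add: card_Pow)
      finally show "real (card (Pow E' - {{}})) \<le> 2 ^ l" by (metis of_nat_le_iff of_nat_numeral of_nat_power)
      show "0 \<le> (2 * m * l) ^ v * ?Q" using p Phi by simp
    qed
    finally show "(\<Sum>c\<in>?N. p ^ card (snd c - F)) \<le> 2 ^ l * (2 * m * l) ^ v * ?Q" by (simp add: mult.assoc)
  qed
qed

text \<open>Let J attain the minimum \<Phi>. Copies of H are grouped by the image of the non-root
  edges of J, and there are at most as many groups as copies of J. In
  \<open>variance_lower_bound\<close> this number times the probability of a copy of J is exactly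
  \<Phi>.\<close>

lemma variance_copies:
  assumes p: "0 \<le> p" "p \<le> 1"
  shows "(mu_ext n p vG VH EH)\<^sup>2 * (1 - p) \<le> Phi_ext n p vG VH EH *
    bexp (Kn_edges n) p (\<lambda>E. (copies.W p (cps n [1..<vG+1]) snd l E)\<^sup>2)"
proof -
  let ?xs = "[1..<vG+1]"
  interpret C: copies "Kn_edges n" p "cps n ?xs" snd l by (rule copies_ext[OF p])
  obtain VJ EJ where J: "sub_rooted VJ EJ" and Phi: "Phi_ext n p vG VH EH = mu_ext n p vG VJ EJ"
    using Phi_attained by blast
  interpret J: rooted vG VJ EJ by (rule sub_rooted_rooted(1)[OF J])
  note newJ = sub_rooted_rooted(2)[OF J]
  \<comment> \<open>A copy may come from several embeddings; one is fixed so that each copy of H has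
    a distinguished copy of J inside it.\<close>
  define \<psi> where "\<psi> = inv_into (embeddings n vG VH ?xs) (copy_of vG VH EH)"
  have \<psi>: "\<psi> c \<in> embeddings n vG VH ?xs" "copy_of vG VH EH (\<psi> c) = c" if "c \<in> cps n ?xs" for c
    using that inv_into_into[of c "copy_of vG VH EH"] f_inv_into_f[of c "copy_of vG VH EH"]
    by (auto simp: \<psi>_def ext_copies_def)
  define T where "T c = (\<lambda>e. \<psi> c ` e) ` new_edges vG EJ" for c
  have "(card (cps n ?xs) * p ^ l)\<^sup>2 * (1 - p)
    \<le> card (J.cps n ?xs) * p ^ card (new_edges vG EJ) * C.ex (\<lambda>E. (C.W E)\<^sup>2)"
  proof (rule C.variance_lower_bound)
    fix c assume c: "c \<in> cps n ?xs"
    have "(\<lambda>e. \<psi> c ` e) ` new_edges vG EJ \<subseteq> snd (copy_of vG VH EH (\<psi> c))"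
      unfolding snd_copy_of using newJ by auto
    then show "T c \<subseteq> snd c" using \<psi>(2)[OF c] by (simp add: T_def)
    show "card (T c) = card (new_edges vG EJ)"
      unfolding T_def by (rule card_image, rule inj_on_subset[OF inj_on_edges[OF \<psi>(1)[OF c]] newJ])
  next
    show "0 < card (new_edges vG EJ)" by (rule J.l_pos)
    have "T ` cps n ?xs \<subseteq> snd ` J.cps n ?xs"
    proof
      fix t assume "t \<in> T ` cps n ?xs"
      then obtain c where c: "c \<in> cps n ?xs" "t = T c" by auto
      have "\<psi> c \<in> embeddings n vG VJ ?xs"
        using \<psi>(1)[OF c(1)] J unfolding embeddings_def sub_rooted_def by (blast intro: inj_on_subset)
      moreover have "t = snd (copy_of vG VJ EJ (\<psi> c))" using c(2) by (simp add: T_def J.snd_copy_of)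
      ultimately show "t \<in> snd ` J.cps n ?xs" by (auto simp: ext_copies_def)
    qed
    then have "card (T ` cps n ?xs) \<le> card (snd ` J.cps n ?xs)"
      using J.finite_cps by (intro card_mono) auto
    also have "\<dots> \<le> card (J.cps n ?xs)" using J.finite_cps by (rule card_image_le)
    finally show "card (T ` cps n ?xs) \<le> card (J.cps n ?xs)" .
  qed
  then show ?thesis unfolding Phi mu_ext_eq[OF p] J.mu_ext_eq[OF p] .
qed

end

subsection \<open>Upper tail and small ball probabilities\<close>

lemma tendsto_one_prob:
  fixes P :: "nat \<Rightarrow> real"
  assumes le: "\<And>n. P n \<le> 1" and ge: "\<And>\<eta>. 0 < \<eta> \<Longrightarrow> \<forall>\<^sub>F n in sequentially. 1 - \<eta> \<le> P n"
  shows "P \<longlonglongrightarrow> 1"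
proof (rule order_tendstoI)
  fix a :: real
  assume "a < 1"
  then have "\<forall>\<^sub>F n in sequentially. 1 - (1 - a) / 2 \<le> P n" by (intro ge) simp
  then show "\<forall>\<^sub>F n in sequentially. a < P n"
    using \<open>a < 1\<close> by (elim eventually_mono) (simp add: field_simps)
next
  fix a :: real
  assume "1 < a"
  then show "\<forall>\<^sub>F n in sequentially. P n < a"
    using le by (intro always_eventually allI) (meson le_less_trans)
qed

context rooted
begin

abbreviation "mu n p \<equiv> mu_ext n p vG VH EH"
abbreviation "Phi n p \<equiv> Phi_ext n p vG VH EH"
abbreviation "X n xs E \<equiv> X_ext n vG VH EH xs E"

lemma W_eq:
  assumes p: "0 \<le> p" "p \<le> 1" and "xs \<in> tuples n vG" "vG \<le> n"
  shows "copies.W p (cps n xs) snd l E = X n xs E - mu n p"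
proof -
  interpret C: copies "Kn_edges n" p "cps n xs" snd l by (rule copies_ext[OF p])
  show ?thesis
    unfolding C.W_def C.Y_def X_ext_eq mu_ext_eq[OF p] card_cps_eq[OF assms(3,4), symmetric]
    by (simp add: sum_subtractf)
qed

lemma mu_ge_Phi: "Phi n p \<le> mu n p"
  by (rule Phi_le[OF sub_rooted_self])

text \<open>The factor \<open>2 ^ l * (2 * m * l) ^ v\<close> comes from
  \<open>overlap_copies\<close>; \<open>(2 * v) ^ v\<close> is the loss from
  \<open>card_cps_lower\<close> in replacing \<open>real n ^ v * p ^ l\<close> by \<mu>.\<close>

definition overlap_const :: "nat \<Rightarrow> real" where
  "overlap_const m = 2 ^ l * (2 * m * l) ^ v * (2 * v) ^ v"

lemma overlap_const_nonneg: "0 \<le> overlap_const m" by (simp add: overlap_const_def)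

lemma overlap_mu:
  assumes p: "0 \<le> p" "p \<le> 1" and m: "1 \<le> m" and Phi: "0 < Phi n p" and n: "2 * card VH \<le> n"
  shows "copies.overlap (Kn_edges n) p (cps n xs) snd l m (overlap_const m * mu n p / Phi n p)"
proof -
  interpret C: copies "Kn_edges n" p "cps n xs" snd l by (rule copies_ext[OF p])
  have "real n ^ v * p ^ l \<le> (2 * v) ^ v * mu n p"
    unfolding mu_ext_eq[OF p] mult.assoc[symmetric] using card_cps_lower[OF n] p
    by (intro mult_right_mono) auto
  then have "2 ^ l * (2 * m * l) ^ v * (real n ^ v * p ^ l / Phi n p)
    \<le> 2 ^ l * (2 * m * l) ^ v * ((2 * v) ^ v * mu n p / Phi n p)"
    using Phi by (intro mult_left_mono divide_right_mono) auto
  also have "\<dots> = overlap_const m * mu n p / Phi n p" by (simp add: overlap_const_def)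
  finally show ?thesis
    using overlap_copies[OF p m Phi, of xs] unfolding C.overlap_def by (meson order_trans)
qed

text \<open>The lower bound \<open>c\<close> on \<Phi> makes \<open>M + D\<close> at most a constant
  multiple of \<mu>, so \<open>(M + D) * D\<close> in the moment bound is at most a constant times
  \<open>\<mu>\<^sup>2 / \<Phi>\<close>.\<close>

lemma upper_tail:
  assumes p: "0 \<le> p" "p \<le> 1" and c: "0 < c" "c \<le> Phi n p" and n: "2 * card VH \<le> n"
    and k: "1 \<le> k" and t: "0 < t"
  shows "bexp (Kn_edges n) p (\<lambda>E. of_bool (\<exists>xs\<in>tuples n vG. t \<le> \<bar>X n xs E - mu n p\<bar>))
    \<le> real n ^ vG * (16 * (1 + overlap_const (2 * k) / c) * overlap_const (2 * k) * ((mu n p)\<^sup>2 / (Phi n p * t\<^sup>2))) ^ k"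
proof -
  let ?C = "overlap_const (2 * k)"
  let ?D = "?C * mu n p / Phi n p"
  let ?R = "(16 * (1 + ?C / c) * ?C * ((mu n p)\<^sup>2 / (Phi n p * t\<^sup>2))) ^ k"
  interpret R: random_subset "Kn_edges n" p
    by unfold_locales (use p finite_Kn_edges in auto)
  have Phi: "0 < Phi n p" and mu: "0 < mu n p" using c mu_ge_Phi[of n p] by auto
  have vGn: "vG \<le> n" using n card_VH by simp
  have single: "R.ex (\<lambda>E. of_bool (t \<le> \<bar>X n xs E - mu n p\<bar>)) \<le> ?R" if xs: "xs \<in> tuples n vG" for xs
  proof -
    interpret C: copies "Kn_edges n" p "cps n xs" snd l by (rule copies_ext[OF p])
    have M: "C.M = mu n p" by (simp add: C.M_eq mu_ext_eq[OF p] card_cps_eq[OF xs vGn])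
    have ov: "C.overlap (2 * k) ?D" using overlap_mu[OF p _ Phi n] k by simp
    have "R.ex (\<lambda>E. of_bool (t \<le> \<bar>X n xs E - mu n p\<bar>)) \<le> R.ex (\<lambda>E. of_bool (t ^ (2 * k) \<le> C.W E ^ (2 * k)))"
    proof (rule R.ex_mono)
      fix E
      have "t ^ (2 * k) \<le> (X n xs E - mu n p) ^ (2 * k)" if "t \<le> \<bar>X n xs E - mu n p\<bar>"
        using power_mono[OF that, of "2 * k"] t by (simp add: power_even_abs)
      then show "of_bool (t \<le> \<bar>X n xs E - mu n p\<bar>) \<le> (of_bool (t ^ (2 * k) \<le> C.W E ^ (2 * k)) :: real)"
        unfolding W_eq[OF p xs vGn] by simp
    qed
    also have "\<dots> \<le> R.ex (\<lambda>E. C.W E ^ (2 * k)) / t ^ (2 * k)"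
      using t by (intro R.ex_markov) (auto simp: zero_le_even_power)
    also have "\<dots> \<le> (16 * ((mu n p + ?D) * ?D)) ^ k / t ^ (2 * k)"
      using C.moment_bound[OF ov] t unfolding M by (intro divide_right_mono) auto
    also have "\<dots> = (16 * ((mu n p + ?D) * ?D) / t\<^sup>2) ^ k"
      unfolding power_divide power_mult ..
    also have "\<dots> \<le> ?R"
    proof (rule power_mono)
      have "mu n p + ?D = (1 + ?C / Phi n p) * mu n p" by (simp add: distrib_right)
      also have "\<dots> \<le> (1 + ?C / c) * mu n p"
        using c Phi mu overlap_const_nonneg by (intro mult_right_mono add_left_mono divide_left_mono) auto
      finally have "(mu n p + ?D) * ?D \<le> ((1 + ?C / c) * mu n p) * ?D"
        using Phi mu overlap_const_nonneg by (intro mult_right_mono) auto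
      then have "16 * ((mu n p + ?D) * ?D) / t\<^sup>2 \<le> 16 * (((1 + ?C / c) * mu n p) * ?D) / t\<^sup>2"
        by (intro divide_right_mono mult_left_mono) auto
      also have "\<dots> = 16 * (1 + ?C / c) * ?C * ((mu n p)\<^sup>2 / (Phi n p * t\<^sup>2))"
        by (simp add: power2_eq_square)
      finally show "16 * ((mu n p + ?D) * ?D) / t\<^sup>2 \<le> 16 * (1 + ?C / c) * ?C * ((mu n p)\<^sup>2 / (Phi n p * t\<^sup>2))" .
      show "0 \<le> 16 * ((mu n p + ?D) * ?D) / t\<^sup>2" using Phi mu overlap_const_nonneg by simp
    qed
    finally show ?thesis .
  qed
  have "R.ex (\<lambda>E. of_bool (\<exists>xs\<in>tuples n vG. t \<le> \<bar>X n xs E - mu n p\<bar>))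
    \<le> R.ex (\<lambda>E. \<Sum>xs\<in>tuples n vG. of_bool (t \<le> \<bar>X n xs E - mu n p\<bar>))"
  proof (rule R.ex_mono)
    fix E
    show "of_bool (\<exists>xs\<in>tuples n vG. t \<le> \<bar>X n xs E - mu n p\<bar>)
      \<le> (\<Sum>xs\<in>tuples n vG. of_bool (t \<le> \<bar>X n xs E - mu n p\<bar>) :: real)"
    proof (cases "\<exists>xs\<in>tuples n vG. t \<le> \<bar>X n xs E - mu n p\<bar>")
      case True
      then obtain xs where xs: "xs \<in> tuples n vG" "t \<le> \<bar>X n xs E - mu n p\<bar>" by blast
      have "(of_bool (t \<le> \<bar>X n xs E - mu n p\<bar>) :: real)
        \<le> (\<Sum>xs\<in>tuples n vG. of_bool (t \<le> \<bar>X n xs E - mu n p\<bar>))"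
        by (rule member_le_sum[OF xs(1)]) (auto simp: finite_tuples)
      then show ?thesis using xs by simp
    qed (simp add: sum_nonneg)
  qed
  also have "\<dots> = (\<Sum>xs\<in>tuples n vG. R.ex (\<lambda>E. of_bool (t \<le> \<bar>X n xs E - mu n p\<bar>)))" by (rule R.ex_sum)
  also have "\<dots> \<le> (\<Sum>xs\<in>tuples n vG. ?R)" by (intro sum_mono single)
  also have "\<dots> = real (card (tuples n vG)) * ?R" by simp
  also have "\<dots> \<le> real n ^ vG * ?R"
  proof (rule mult_right_mono)
    show "real (card (tuples n vG)) \<le> real n ^ vG"
      using card_tuples_le by (metis of_nat_le_iff of_nat_power)
    show "0 \<le> ?R" using Phi mu overlap_const_nonneg c t by simp
  qed
  finally show ?thesis .
qed

text \<open>\<open>anticoncentration\<close> is applied at radius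
  \<open>\<delta> * \<sigma>\<close>, where \<sigma> is the standard deviation. By
  \<open>variance_copies\<close>, \<sigma> is at least
  \<open>sqrt (1 - p) * \<mu> / sqrt \<Phi>\<close>. Hence the assumption on \<epsilon> puts the
  event inside that interval, and the third-order error, divided by \<open>\<sigma> ^ 3\<close>,
  turns into the last summand.\<close>

lemma small_ball:
  assumes p: "0 \<le> p" "p < 1" and Phi: "0 < Phi n p" and n: "2 * card VH \<le> n"
    and \<delta>: "0 < \<delta>" and \<epsilon>: "0 < \<epsilon>" "\<epsilon>\<^sup>2 * Phi n p / (1 - p) \<le> \<delta>\<^sup>2"
  shows "bexp (Kn_edges n) p (\<lambda>E. of_bool (\<bar>X n [1..<vG+1] E - mu n p\<bar> < \<epsilon> * mu n p))
    \<le> 4 * \<delta> + 6 * (16 + 2 * real l * 8 ^ l) * (overlap_const 2)\<^sup>2 / (\<delta> * sqrt (Phi n p * (1 - p)))"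
proof -
  let ?xs = "[1..<vG+1]"
  have p': "p \<le> 1" using p by simp
  interpret C: copies "Kn_edges n" p "cps n ?xs" snd l by (rule copies_ext[OF p(1) p'])
  have vGn: "vG \<le> n" using n card_VH by simp
  have W: "C.W E = X n ?xs E - mu n p" for E
    by (rule W_eq[OF p(1) p' initial_tuple[OF vGn] vGn])
  have M: "C.M = mu n p" by (simp only: C.M_eq mu_ext_eq[OF p(1) p'])
  have mu: "0 < mu n p" using Phi mu_ge_Phi[of n p] by linarith
  \<comment> \<open>In terms of these two square roots every exponent below is an integer.\<close>
  define x where "x = sqrt (1 - p)"
  define y where "y = sqrt (Phi n p)"
  define \<mu> where "\<mu> = mu n p"
  define K where "K = overlap_const 2"
  define V where "V = C.ex (\<lambda>E. (C.W E)\<^sup>2)"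
  define \<sigma> where "\<sigma> = sqrt V"
  define \<tau> where "\<tau> = x * \<mu> / y"
  have x: "0 < x" "1 - p = x\<^sup>2" and y: "0 < y" "Phi n p = y\<^sup>2" and \<mu>: "0 < \<mu>"
    using p Phi mu by (auto simp: x_def y_def \<mu>_def)
  have "\<mu>\<^sup>2 * x\<^sup>2 \<le> y\<^sup>2 * V"
    using variance_copies[OF p(1) p', of n] unfolding V_def \<mu>_def x y .
  then have "\<tau>\<^sup>2 \<le> V"
    using y by (simp add: \<tau>_def power_mult_distrib power_divide divide_le_eq mult.commute)
  then have \<tau>: "\<tau> \<le> \<sigma>" unfolding \<sigma>_def by (rule real_le_rsqrt)
  have \<tau>0: "0 < \<tau>" using x y \<mu> by (simp add: \<tau>_def)
  then have \<sigma>: "0 < \<sigma>" using \<tau> by linarith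
  have V: "V = \<sigma>\<^sup>2" unfolding \<sigma>_def V_def by (rule real_sqrt_pow2[symmetric]) (rule C.ex_nonneg, simp)
  define Q where "Q = C.ex (\<lambda>E. of_bool (\<bar>C.W E\<bar> \<le> \<delta> * \<sigma>))"
  have ov: "C.overlap 2 (K * \<mu> / y\<^sup>2)"
    using overlap_mu[OF p(1) p' _ Phi n, of 2] unfolding K_def \<mu>_def y by simp
  have "\<sigma>\<^sup>2 / 2 * Q \<le> 2 * (\<delta> * \<sigma>) * \<sigma> + 3 * C.stein_const * x\<^sup>2 * \<mu> * (K * \<mu> / y\<^sup>2)\<^sup>2 / (\<delta> * \<sigma>)"
    using C.anticoncentration[OF ov, of "\<delta> * \<sigma>"] \<delta> \<sigma>
    unfolding V_def[symmetric] Q_def[symmetric] M x \<mu>_def[symmetric] \<sigma>_def[symmetric] unfolding V by simp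
  then have "Q \<le> (2 * (\<delta> * \<sigma>) * \<sigma> + 3 * C.stein_const * x\<^sup>2 * \<mu> * (K * \<mu> / y\<^sup>2)\<^sup>2 / (\<delta> * \<sigma>)) / (\<sigma>\<^sup>2 / 2)"
    using \<sigma> by (simp add: le_divide_eq mult.commute)
  also have "\<dots> = 4 * \<delta> + 6 * C.stein_const * x\<^sup>2 * \<mu> * (K * \<mu> / y\<^sup>2)\<^sup>2 / (\<delta> * \<sigma> ^ 3)"
    using \<sigma> \<delta> by (simp add: field_simps power2_eq_square power3_eq_cube)
  also have "6 * C.stein_const * x\<^sup>2 * \<mu> * (K * \<mu> / y\<^sup>2)\<^sup>2 / (\<delta> * \<sigma> ^ 3)
    \<le> 6 * C.stein_const * x\<^sup>2 * \<mu> * (K * \<mu> / y\<^sup>2)\<^sup>2 / (\<delta> * \<tau> ^ 3)"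
    using \<delta> \<tau> \<tau>0 \<mu> C.stein_const_pos \<sigma> by (intro divide_left_mono mult_left_mono power_mono mult_nonneg_nonneg mult_pos_pos) auto
  also have "\<dots> = 6 * C.stein_const * K\<^sup>2 / (\<delta> * (y * x))"
    using x y \<mu> \<delta> by (simp add: \<tau>_def field_simps power2_eq_square power3_eq_cube)
  also have "y * x = sqrt (Phi n p * (1 - p))" by (simp add: x_def y_def real_sqrt_mult)
  finally have Q: "Q \<le> 4 * \<delta> + 6 * C.stein_const * K\<^sup>2 / (\<delta> * sqrt (Phi n p * (1 - p)))" by simp
  have "\<epsilon> * \<mu> \<le> \<delta> * \<sigma>"
  proof -
    have "(\<epsilon> * y)\<^sup>2 \<le> (\<delta> * x)\<^sup>2"
      using \<epsilon>(2) x(1) unfolding x y by (simp add: divide_le_eq power_mult_distrib)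
    then have "\<epsilon> * y \<le> \<delta> * x" by (rule power2_le_imp_le) (use \<delta> x in simp)
    then have "\<epsilon> \<le> \<delta> * x / y" using y by (simp add: le_divide_eq)
    then have "\<epsilon> * \<mu> \<le> \<delta> * x / y * \<mu>" using \<mu> by (intro mult_right_mono) auto
    also have "\<dots> = \<delta> * \<tau>" by (simp add: \<tau>_def)
    also have "\<dots> \<le> \<delta> * \<sigma>" using \<tau> \<delta> by (intro mult_left_mono) auto
    finally show ?thesis .
  qed
  then have "C.ex (\<lambda>E. of_bool (\<bar>X n ?xs E - mu n p\<bar> < \<epsilon> * mu n p)) \<le> Q"
    unfolding Q_def W \<mu>_def by (intro C.ex_mono) auto
  then show ?thesis using Q unfolding C.stein_const_def K_def by linarith
qed

text \<open>If J attains the minimum \<Phi>, every copy of H contains a copy of J, so this is the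
  first moment bound for copies of J.\<close>

lemma no_copies:
  assumes p: "0 \<le> p" "p \<le> 1"
  shows "bexp (Kn_edges n) p (\<lambda>E. of_bool (X n [1..<vG+1] E \<noteq> 0)) \<le> Phi n p"
proof -
  let ?xs = "[1..<vG+1]"
  interpret R: random_subset "Kn_edges n" p
    by unfold_locales (use p finite_Kn_edges in auto)
  obtain VJ EJ where J: "sub_rooted VJ EJ" and Phi: "Phi n p = mu_ext n p vG VJ EJ"
    using Phi_attained by blast
  interpret J: rooted vG VJ EJ by (rule sub_rooted_rooted(1)[OF J])
  have "R.ex (\<lambda>E. of_bool (X n ?xs E \<noteq> 0)) \<le> R.ex (X_ext n vG VJ EJ ?xs)"
  proof (rule R.ex_mono)
    fix E
    show "of_bool (X n ?xs E \<noteq> 0) \<le> X_ext n vG VJ EJ ?xs E"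
    proof (cases "X n ?xs E = 0")
      case True
      then show ?thesis by (simp add: X_ext_def)
    next
      case False
      have "\<exists>c\<in>cps n ?xs. snd c \<subseteq> E"
      proof (rule ccontr)
        assume "\<not> (\<exists>c\<in>cps n ?xs. snd c \<subseteq> E)"
        then have "X n ?xs E = 0" unfolding X_ext_eq by (intro sum.neutral) auto
        then show False using False by simp
      qed
      then obtain c where c: "c \<in> cps n ?xs" "snd c \<subseteq> E" by blast
      then obtain \<phi> where \<phi>: "\<phi> \<in> embeddings n vG VH ?xs" "c = copy_of vG VH EH \<phi>"
        unfolding ext_copies_def by blast
      have "\<phi> \<in> embeddings n vG VJ ?xs"
        using \<phi>(1) J unfolding embeddings_def sub_rooted_def by (blast intro: inj_on_subset)
      then have c': "copy_of vG VJ EJ \<phi> \<in> J.cps n ?xs" by (simp add: ext_copies_def)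
      have "snd (copy_of vG VJ EJ \<phi>) \<subseteq> snd c"
        unfolding \<phi>(2) snd_copy_of J.snd_copy_of using sub_rooted_rooted(2)[OF J] by (rule image_mono)
      then have "(1::real) = of_bool (snd (copy_of vG VJ EJ \<phi>) \<subseteq> E)" using c(2) by auto
      also have "\<dots> \<le> X_ext n vG VJ EJ ?xs E"
        unfolding J.X_ext_eq by (rule member_le_sum[OF c']) (auto simp: J.finite_cps)
      finally show ?thesis using False by simp
    qed
  qed
  then show ?thesis unfolding Phi mu_ext_def expectation_Gnp[OF p] .
qed

end

section \<open>The limit statements for sequences \<open>p\<close>, \<open>t\<close> and
  \<open>eps\<close>\<close>

theorem theorem9:
  fixes vG :: nat and VH :: "nat set" and EH :: "nat set set"
    and p t eps :: "nat \<Rightarrow> real"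
  assumes rg: "rooted_graph vG VH EH"
    and p01: "\<And>n. 0 \<le> p n \<and> p n \<le> 1"
  shows
   "((\<exists>c>0. \<forall>\<^sub>F n in sequentially. Phi_ext n (p n) vG VH EH \<ge> c) \<and>
     (\<forall>n. t n > 0) \<and>
     (\<exists>c>0. \<forall>\<^sub>F n in sequentially.
        (t n / mu_ext n (p n) vG VH EH)^2 * Phi_ext n (p n) vG VH EH \<ge> real n powr c)
     \<longrightarrow> ((\<lambda>n. measure_pmf.prob (Gnp n (p n))
            {E. \<forall>xs\<in>tuples n vG.
                 \<bar>X_ext n vG VH EH xs E - mu_ext n (p n) vG VH EH\<bar> < t n})
          \<longlonglongrightarrow> 1))
    \<and>
    ((\<forall>n. 0 < eps n \<and> eps n \<le> 1) \<and>
     ((filterlim (\<lambda>n. Phi_ext n (p n) vG VH EH * (1 - p n)) at_top sequentially \<and>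
       ((\<lambda>n. (eps n)^2 * Phi_ext n (p n) vG VH EH / (1 - p n)) \<longlonglongrightarrow> 0))
      \<or> ((\<lambda>n. Phi_ext n (p n) vG VH EH) \<longlonglongrightarrow> 0))
     \<longrightarrow> ((\<lambda>n. measure_pmf.prob (Gnp n (p n))
            {E. \<exists>xs\<in>tuples n vG.
                 \<bar>X_ext n vG VH EH xs E - mu_ext n (p n) vG VH EH\<bar>
                   \<ge> eps n * mu_ext n (p n) vG VH EH})
          \<longlonglongrightarrow> 1))"
proof -
  interpret rooted vG VH EH by unfold_locales (rule rg)
  let ?\<mu> = "\<lambda>n. mu n (p n)"
  let ?\<Phi> = "\<lambda>n. Phi n (p n)"
  let ?xs = "[1..<vG+1]"
  have p: "0 \<le> p n" "p n \<le> 1" for n using p01 by auto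
  have compl: "bexp (Kn_edges n) (p n) (\<lambda>E. of_bool (P E)) = 1 - bexp (Kn_edges n) (p n) (\<lambda>E. of_bool (\<not> P E))"
    for P n
  proof -
    interpret random_subset "Kn_edges n" "p n" by unfold_locales (use p finite_Kn_edges in auto)
    have "ex (\<lambda>E. of_bool (P E)) = ex (\<lambda>E. 1 - of_bool (\<not> P E))" by (rule ex_cong) simp
    then show ?thesis by (simp add: ex_diff ex_const)
  qed
  have mono: "bexp (Kn_edges n) (p n) (\<lambda>E. of_bool (P E)) \<le> bexp (Kn_edges n) (p n) (\<lambda>E. of_bool (P' E))"
    if "\<And>E. P E \<Longrightarrow> P' E" for P P' n
  proof -
    interpret random_subset "Kn_edges n" "p n" by unfold_locales (use p finite_Kn_edges in auto)
    show ?thesis using that by (intro ex_mono) auto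
  qed
  have large: "\<forall>\<^sub>F n in sequentially. 2 * card VH \<le> n" by (rule eventually_ge_at_top)
  show ?thesis
  proof (intro conjI impI)
    assume "(\<exists>c>0. \<forall>\<^sub>F n in sequentially. c \<le> ?\<Phi> n) \<and> (\<forall>n. 0 < t n) \<and>
      (\<exists>c>0. \<forall>\<^sub>F n in sequentially. real n powr c \<le> (t n / ?\<mu> n)\<^sup>2 * ?\<Phi> n)"
    then obtain c c' where c: "0 < c" "\<forall>\<^sub>F n in sequentially. c \<le> ?\<Phi> n" and t: "\<And>n. 0 < t n"
      and c': "0 < c'" "\<forall>\<^sub>F n in sequentially. real n powr c' \<le> (t n / ?\<mu> n)\<^sup>2 * ?\<Phi> n" by auto
    \<comment> \<open>With \<open>c' * k \<ge> vG + 1\<close> the decay of the \<open>k\<close>-th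
      power beats the \<open>n ^ vG\<close> root tuples and leaves a factor \<open>1 / n\<close>.
      The maximum with 1 is taken because \<open>upper_tail\<close> needs a positive
      \<open>k\<close>.\<close>
    obtain k0 where k0: "(real vG + 1) / c' \<le> real k0" using real_arch_simple by blast
    define k where "k = max 1 k0"
    have k: "1 \<le> k" "real vG + 1 \<le> c' * k"
      using k0 c'(1) by (auto simp: k_def field_simps intro: order_trans)
    define B where "B = 16 * (1 + overlap_const (2 * k) / c) * overlap_const (2 * k)"
    have B: "0 \<le> B" using c overlap_const_nonneg by (simp add: B_def)
    show "(\<lambda>n. measure_pmf.prob (Gnp n (p n)) {E. \<forall>xs\<in>tuples n vG. \<bar>X n xs E - ?\<mu> n\<bar> < t n}) \<longlonglongrightarrow> 1"
    proof (rule tendsto_one_prob)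
      fix \<eta> :: real assume \<eta>: "0 < \<eta>"
      have "(\<lambda>n. B ^ k * inverse (real n)) \<longlonglongrightarrow> B ^ k * 0"
        by (intro tendsto_intros lim_inverse_n)
      then have "\<forall>\<^sub>F n in sequentially. B ^ k * inverse (real n) < \<eta>"
        using \<eta> by (intro order_tendstoD(2)) auto
      then show "\<forall>\<^sub>F n in sequentially. 1 - \<eta> \<le>
          measure_pmf.prob (Gnp n (p n)) {E. \<forall>xs\<in>tuples n vG. \<bar>X n xs E - ?\<mu> n\<bar> < t n}"
        using c(2) c'(2) large eventually_ge_at_top[of 1]
      proof eventually_elim
        case (elim n)
        have Phi: "0 < ?\<Phi> n" using c elim by linarith
        then have mu: "0 < ?\<mu> n" using mu_ge_Phi[of n "p n"] by linarith
        have n1: "1 \<le> real n" using elim by simp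
        have "(?\<mu> n)\<^sup>2 / (?\<Phi> n * (t n)\<^sup>2) = inverse ((t n / ?\<mu> n)\<^sup>2 * ?\<Phi> n)"
          by (simp add: power_divide mult.commute)
        also have "\<dots> \<le> inverse (real n powr c')"
          using elim n1 by (intro le_imp_inverse_le) auto
        also have "\<dots> = real n powr (- c')" by (simp add: powr_minus)
        finally have "(B * ((?\<mu> n)\<^sup>2 / (?\<Phi> n * (t n)\<^sup>2))) ^ k \<le> (B * real n powr (- c')) ^ k"
          using B Phi by (intro power_mono mult_left_mono) auto
        also have "\<dots> = B ^ k * real n powr (- c' * k)"
          using n1 by (simp add: power_mult_distrib powr_power mult.commute)
        finally have "real n ^ vG * (B * ((?\<mu> n)\<^sup>2 / (?\<Phi> n * (t n)\<^sup>2))) ^ k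
          \<le> real n powr (real vG) * (B ^ k * real n powr (- c' * k))"
          using n1 by (simp add: powr_realpow mult_left_mono)
        also have "\<dots> = B ^ k * real n powr (real vG - c' * k)"
          by (simp add: powr_add[symmetric] mult.left_commute)
        also have "\<dots> \<le> B ^ k * real n powr (- 1)"
          using n1 k B by (intro mult_left_mono powr_mono) auto
        also have "\<dots> = B ^ k * inverse (real n)" using n1 by (simp add: powr_minus)
        finally have "bexp (Kn_edges n) (p n) (\<lambda>E. of_bool (\<exists>xs\<in>tuples n vG. t n \<le> \<bar>X n xs E - ?\<mu> n\<bar>)) \<le> \<eta>"
          using upper_tail[OF p c(1) elim(2) elim(4) k(1) t[of n]] elim(1) unfolding B_def by linarith
        moreover have "measure_pmf.prob (Gnp n (p n)) {E. \<forall>xs\<in>tuples n vG. \<bar>X n xs E - ?\<mu> n\<bar> < t n}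
          = 1 - bexp (Kn_edges n) (p n) (\<lambda>E. of_bool (\<exists>xs\<in>tuples n vG. t n \<le> \<bar>X n xs E - ?\<mu> n\<bar>))"
          unfolding prob_Gnp[OF p] by (subst compl) (simp add: not_less)
        ultimately show ?case by linarith
      qed
    qed simp
  next
    assume asm: "(\<forall>n. 0 < eps n \<and> eps n \<le> 1) \<and>
      (filterlim (\<lambda>n. ?\<Phi> n * (1 - p n)) at_top sequentially \<and>
       (\<lambda>n. (eps n)\<^sup>2 * ?\<Phi> n / (1 - p n)) \<longlonglongrightarrow> 0 \<or> ?\<Phi> \<longlonglongrightarrow> 0)"
    then have eps: "0 < eps n" "eps n \<le> 1" for n by auto
    \<comment> \<open>A large deviation at the single tuple \<open>?xs\<close> suffices; it is an
      admissible tuple once \<open>vG \<le> n\<close>.\<close>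
    have reduce: "1 - bexp (Kn_edges n) (p n) (\<lambda>E. of_bool (\<bar>X n ?xs E - ?\<mu> n\<bar> < eps n * ?\<mu> n))
      \<le> measure_pmf.prob (Gnp n (p n)) {E. \<exists>xs\<in>tuples n vG. eps n * ?\<mu> n \<le> \<bar>X n xs E - ?\<mu> n\<bar>}"
      if "2 * card VH \<le> n" for n
    proof -
      have "?xs \<in> tuples n vG" using that card_VH by (intro initial_tuple) simp
      then have "bexp (Kn_edges n) (p n) (\<lambda>E. of_bool (eps n * ?\<mu> n \<le> \<bar>X n ?xs E - ?\<mu> n\<bar>))
        \<le> bexp (Kn_edges n) (p n) (\<lambda>E. of_bool (\<exists>xs\<in>tuples n vG. eps n * ?\<mu> n \<le> \<bar>X n xs E - ?\<mu> n\<bar>))"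
        by (intro mono) blast
      then show ?thesis
        unfolding prob_Gnp[OF p]
        using compl[of n "\<lambda>E. eps n * ?\<mu> n \<le> \<bar>X n ?xs E - ?\<mu> n\<bar>"] by (simp add: not_le)
    qed
    show "(\<lambda>n. measure_pmf.prob (Gnp n (p n)) {E. \<exists>xs\<in>tuples n vG. eps n * ?\<mu> n \<le> \<bar>X n xs E - ?\<mu> n\<bar>}) \<longlonglongrightarrow> 1"
    proof (rule tendsto_one_prob)
      fix \<eta> :: real assume \<eta>: "0 < \<eta>"
      have "\<forall>\<^sub>F n in sequentially.
        bexp (Kn_edges n) (p n) (\<lambda>E. of_bool (\<bar>X n ?xs E - ?\<mu> n\<bar> < eps n * ?\<mu> n)) \<le> \<eta>"
        using asm
      proof (elim conjE disjE)
        assume inf: "filterlim (\<lambda>n. ?\<Phi> n * (1 - p n)) at_top sequentially"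
          and zero: "(\<lambda>n. (eps n)\<^sup>2 * ?\<Phi> n / (1 - p n)) \<longlonglongrightarrow> 0"
        \<comment> \<open>This choice turns the term \<open>4 * \<delta>\<close> of
          \<open>small_ball\<close> into \<open>\<eta> / 2\<close>.\<close>
        define \<delta> where "\<delta> = \<eta> / 8"
        have \<delta>: "0 < \<delta>" using \<eta> by (simp add: \<delta>_def)
        define A where "A = 6 * (16 + 2 * real l * 8 ^ l) * (overlap_const 2)\<^sup>2 / \<delta>"
        have "filterlim (\<lambda>n. sqrt (?\<Phi> n * (1 - p n))) at_top sequentially"
          by (rule filterlim_compose[OF sqrt_at_top inf])
        then have "(\<lambda>n. A / sqrt (?\<Phi> n * (1 - p n))) \<longlonglongrightarrow> 0"
          by (intro tendsto_divide_0[OF tendsto_const] filterlim_at_top_imp_at_infinity)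
        then have "\<forall>\<^sub>F n in sequentially. A / sqrt (?\<Phi> n * (1 - p n)) < \<eta> / 2"
          using \<eta> by (intro order_tendstoD(2)) auto
        moreover have "\<forall>\<^sub>F n in sequentially. (eps n)\<^sup>2 * ?\<Phi> n / (1 - p n) < \<delta>\<^sup>2"
          using zero \<delta> by (intro order_tendstoD(2)) auto
        \<comment> \<open>As \<open>1 - p n\<close> is nonnegative, a positive product gives both
          \<Phi> > 0 and \<open>p n < 1\<close>, which \<open>small_ball\<close> requires.\<close>
        moreover have "\<forall>\<^sub>F n in sequentially. 0 < ?\<Phi> n * (1 - p n)"
          using inf by (simp add: filterlim_at_top_dense)
        ultimately show ?thesis
          using large
        proof eventually_elim
          case (elim n)
          then have "0 < ?\<Phi> n" "p n < 1"
            using p[of n] by (auto simp: zero_less_mult_iff)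
          then have "bexp (Kn_edges n) (p n) (\<lambda>E. of_bool (\<bar>X n ?xs E - ?\<mu> n\<bar> < eps n * ?\<mu> n))
            \<le> 4 * \<delta> + 6 * (16 + 2 * real l * 8 ^ l) * (overlap_const 2)\<^sup>2 / (\<delta> * sqrt (?\<Phi> n * (1 - p n)))"
            using elim p[of n] \<delta> eps[of n] by (intro small_ball) auto
          also have "\<dots> = \<eta> / 2 + A / sqrt (?\<Phi> n * (1 - p n))"
            by (simp add: \<delta>_def A_def)
          finally show ?case using elim(1) by linarith
        qed
      next
        assume "?\<Phi> \<longlonglongrightarrow> 0"
        then have "\<forall>\<^sub>F n in sequentially. ?\<Phi> n < \<eta>" using \<eta> by (rule order_tendstoD(2))
        then show ?thesis
        proof eventually_elim
          case (elim n)
          have mu: "0 \<le> ?\<mu> n" unfolding mu_ext_eq[OF p] using p[of n] by simp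
          \<comment> \<open>Since \<open>eps n \<le> 1\<close>, a vanishing count already deviates
            by \<mu>, hence by at least \<open>eps n * ?\<mu> n\<close>.\<close>
          have "eps n * ?\<mu> n \<le> ?\<mu> n" using mu eps[of n] by (simp add: mult_left_le_one_le)
          then have "bexp (Kn_edges n) (p n) (\<lambda>E. of_bool (\<bar>X n ?xs E - ?\<mu> n\<bar> < eps n * ?\<mu> n))
            \<le> bexp (Kn_edges n) (p n) (\<lambda>E. of_bool (X n ?xs E \<noteq> 0))"
            using mu by (intro mono) auto
          also have "\<dots> \<le> ?\<Phi> n" by (rule no_copies[OF p])
          finally show ?case using elim by linarith
        qed
      qed
      then show "\<forall>\<^sub>F n in sequentially. 1 - \<eta> \<le>
        measure_pmf.prob (Gnp n (p n)) {E. \<exists>xs\<in>tuples n vG. eps n * ?\<mu> n \<le> \<bar>X n xs E - ?\<mu> n\<bar>}"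
        using large
      proof eventually_elim
        case (elim n)
        then show ?case using reduce[of n] by linarith
      qed
    qed simp
  qed
qed

end
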